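(* Let $T$ be the integral operator with interaction kernel $R$ (see context), and suppose $R$ is Hilbert–Schmidt, i.e. $\int_{\mathcal X\times\mathcal X}R(x,y)^2\mu(dx)\mu(dy)<\infty$ (so that $T$ is compact). Let $f\in L^2(\mathcal X,\mu)$ be a strictly positive function. For integers $n,m>0$ define the joint density $g_{n,m}$ on $\mathcal X^{n+2m}$, with respect to the $(n+2m)$-fold product of $\mu$, by $$g_{n,m}(x_{-m+1},\ldots,x_0,\ldots,x_{n+1},\ldots,x_{n+m})=C_{n+2m}^{-1}\,f(x_{-m+1})\Big[\prod_{i=-m+2}^{n+m}R(x_{i-1},x_i)\Big]f(x_{n+m}),$$ where $C_{n+2m}$ is the constant of integration, and define the marginal density $$h^{(m-1)}_{[0:n+1]}(x_0,\ldots,x_{n+1})=\int g_{n,m}(x_{-m+1},\ldots,x_{n+m})\prod_{i\in\mathcal I}\mu(dx_i),\qquad \mathcal I=\{-m+1,\ldots,-1\}\cup\{n+2,\ldots,n+m\}.$$ Let $p_{[0:n+1]}$ denote the joint density of $(X_0,\ldots,X_{n+1})$ under the CEStGM process. Then there exists $0\le\rho<1$ such that for all $n$ and $m$, $$\big\|h^{(m-1)}_{[0:n+1]}-p_{[0:n+1]}\big\|_{\mathrm{TV}}=O(\rho^{m-1}),$$ where $\|\cdot\|_{\mathrm{TV}}$ is the total variation distance.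
   Context: Setting. Let $p\ge 1$. For each $a\in\{1,\ldots,p\}$ let $\mathcal X^{(a)}\subseteq\mathbb R$ be measurable with a sigma-finite measure $\mu_a$; $\mathcal X=\prod_{a}\mathcal X^{(a)}$, $\mu=\otimes_{a}\mu_a$. Let $s_a,c_a:\mathcal X^{(a)}\to\mathbb R$ be measurable, $\theta\in\mathbb R^p$, and $\Phi_0,\Phi_1$ real $p\times p$ matrices, $\Phi_0$ symmetric with zero diagonal. With $\mathbf s(x)=(s_a(x^{(a)}))_a$, $\mathbf c(x)=(c_a(x^{(a)}))_a$, put $G(x)=\exp\big(\theta^\top\mathbf s(x)+\mathbf 1_p^\top\mathbf c(x)+\tfrac12x^\top\Phi_0x\big)$, $H(x,y)=\exp(x^\top\Phi_1y)$, and let the interaction kernel be $R(x,y)=G(x)^{1/2}H(x,y)G(y)^{1/2}>0$. Let $T(f)[y]=\int R(x,y)f(x)\mu(dx)$ on $L^2(\mathcal X,\mu)$. CEStGM process: when $T$ is compact, the unique (in law) strictly stationary process $\{X_t\}_{t\in\mathbb Z}$ with values in $\mathcal X$ such that, in particular, for every $n$ the joint density of $(X_0,\ldots,X_{n+1})$ with respect to the $(n+2)$-fold product of $\mu$ is $p_{[0:n+1]}(x_0,\ldots,x_{n+1})=r^{-(n+1)}v(x_0)\big[\prod_{t=1}^{n+1}R(x_{t-1},x_t)\big]w(x_{n+1})$, where $r>0$ is the spectral radius of $T$ and $v,w$ are the a.e. positive eigenfunctions of $T$ and $T^*$ for the eigenvalue $r$ (unique up to scaling, by Krein–Rutman), scaled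 so that $\langle v,w\rangle=1$. The constant in $O(\cdot)$ may depend on $R$, $f$ and $\rho$, but not on $m$ or $n$. *)

theory Defs
  imports "HOL-Probability.Probability"
begin

section \<open>The interaction kernel\<close>

text \<open>Points of the product space are functions \<open>x :: 'p \<Rightarrow> real\<close>, the carrier of the library's
  product measure; the linear algebra is done on the associated vectors \<open>\<chi> a. x a\<close>.\<close>

definition node_factor ::
  "('p::finite \<Rightarrow> real \<Rightarrow> real) \<Rightarrow> ('p \<Rightarrow> real \<Rightarrow> real) \<Rightarrow> real^'p \<Rightarrow> real^'p^'p \<Rightarrow> ('p \<Rightarrow> real) \<Rightarrow> real"
  where
  "node_factor s c \<theta> \<Phi>0 x =
     exp (\<theta> \<bullet> (\<chi> a. s a (x a)) + (\<Sum>a\<in>UNIV. c a (x a)) + 1/2 * ((\<chi> a. x a) \<bullet> (\<Phi>0 *v (\<chi> a. x a))))"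

definition edge_factor :: "real^'p^'p \<Rightarrow> ('p::finite \<Rightarrow> real) \<Rightarrow> ('p \<Rightarrow> real) \<Rightarrow> real" where
  "edge_factor \<Phi>1 x y = exp ((\<chi> a. x a) \<bullet> (\<Phi>1 *v (\<chi> a. y a)))"

definition interaction_kernel ::
  "('p::finite \<Rightarrow> real \<Rightarrow> real) \<Rightarrow> ('p \<Rightarrow> real \<Rightarrow> real) \<Rightarrow> real^'p \<Rightarrow> real^'p^'p \<Rightarrow> real^'p^'p
     \<Rightarrow> ('p \<Rightarrow> real) \<Rightarrow> ('p \<Rightarrow> real) \<Rightarrow> real" where
  "interaction_kernel s c \<theta> \<Phi>0 \<Phi>1 x y =
     sqrt (node_factor s c \<theta> \<Phi>0 x) * edge_factor \<Phi>1 x y * sqrt (node_factor s c \<theta> \<Phi>0 y)"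

section \<open>Integral operators on square-integrable functions\<close>

text \<open>Elements of \<open>L2\<close> are functions, not classes; equalities between them are stated almost
  everywhere. The spectrum is taken on the complex-valued functions, hence the polymorphism.\<close>

definition L2 :: "'a measure \<Rightarrow> ('a \<Rightarrow> 'b::{banach,second_countable_topology}) set" where
  "L2 M = {f \<in> borel_measurable M. integrable M (\<lambda>x. (norm (f x))\<^sup>2)}"

definition L2_norm :: "'a measure \<Rightarrow> ('a \<Rightarrow> 'b::{banach,second_countable_topology}) \<Rightarrow> real" where
  "L2_norm M f = sqrt (\<integral>x. (norm (f x))\<^sup>2 \<partial>M)"

definition kernel_op ::
  "'a measure \<Rightarrow> ('a \<Rightarrow> 'a \<Rightarrow> real) \<Rightarrow> ('a \<Rightarrow> 'b::{banach,second_countable_topology}) \<Rightarrow> 'a \<Rightarrow> 'b" where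
  "kernel_op M R f y = (\<integral>x. R x y *\<^sub>R f x \<partial>M)"

text \<open>The adjoint of an integral operator with real kernel has the transposed kernel;
  see \<open>kernel_op_adjoint\<close> below.\<close>

definition kernel_op_adj ::
  "'a measure \<Rightarrow> ('a \<Rightarrow> 'a \<Rightarrow> real) \<Rightarrow> ('a \<Rightarrow> 'b::{banach,second_countable_topology}) \<Rightarrow> 'a \<Rightarrow> 'b" where
  "kernel_op_adj M R g x = (\<integral>y. R x y *\<^sub>R g y \<partial>M)"

lemma kernel_op_adjoint:
  fixes f g :: "'a \<Rightarrow> complex"
  assumes "sigma_finite_measure M"
    and R: "(\<lambda>(x, y). R x y) \<in> borel_measurable (M \<Otimes>\<^sub>M M)"
    and HS: "integrable (M \<Otimes>\<^sub>M M) (\<lambda>(x, y). (R x y)\<^sup>2)"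
    and f: "f \<in> L2 M" and g: "g \<in> L2 M"
  shows "(\<integral>y. kernel_op M R f y * cnj (g y) \<partial>M) = (\<integral>x. f x * cnj (kernel_op_adj M R g x) \<partial>M)"
proof -
  interpret sigma_finite_measure M by fact
  interpret P: pair_sigma_finite M M ..
  have [measurable]: "f \<in> borel_measurable M" "g \<in> borel_measurable M"
    and i: "integrable M (\<lambda>x. (norm (f x))\<^sup>2)" "integrable M (\<lambda>x. (norm (g x))\<^sup>2)"
    using f g by (auto simp: L2_def)
  note R[measurable]
  have [measurable]: "(\<lambda>y. cnj (g y)) \<in> borel_measurable M"
    by (intro borel_measurable_continuous_on[where f = cnj] continuous_intros) simp
  let ?F = "\<lambda>(x, y). R x y *\<^sub>R (f x * cnj (g y))"
  have "integrable (M \<Otimes>\<^sub>M M) (\<lambda>(x, y). (norm (f x))\<^sup>2 *\<^sub>R (norm (g y))\<^sup>2)"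
  proof (rule P.Fubini_integrable)
    show "integrable M (\<lambda>x. \<integral>y. norm (case (x, y) of (x, y) \<Rightarrow> (norm (f x))\<^sup>2 *\<^sub>R (norm (g y))\<^sup>2) \<partial>M)"
      using i by (simp add: abs_mult)
  qed (use i in auto)
  with HS have "integrable (M \<Otimes>\<^sub>M M)
      (\<lambda>z. (case z of (x, y) \<Rightarrow> (R x y)\<^sup>2) + (case z of (x, y) \<Rightarrow> (norm (f x))\<^sup>2 *\<^sub>R (norm (g y))\<^sup>2))"
    by (rule Bochner_Integration.integrable_add)
  then have F: "integrable (M \<Otimes>\<^sub>M M) ?F"
  proof (rule Bochner_Integration.integrable_bound)
    have *: "\<bar>a\<bar> * (b * c) \<le> a\<^sup>2 + b\<^sup>2 * c\<^sup>2" for a b c :: real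
    proof -
      have "2 * (\<bar>a\<bar> * (b * c)) \<le> a\<^sup>2 + (b * c)\<^sup>2"
        using sum_squares_bound[of "\<bar>a\<bar>" "b * c"] by (simp add: mult.assoc)
      moreover have "0 \<le> a\<^sup>2 + (b * c)\<^sup>2" by simp
      ultimately show ?thesis unfolding power_mult_distrib by linarith
    qed
    show "AE z in M \<Otimes>\<^sub>M M. norm (?F z) \<le>
        norm ((case z of (x, y) \<Rightarrow> (R x y)\<^sup>2) + (case z of (x, y) \<Rightarrow> (norm (f x))\<^sup>2 *\<^sub>R (norm (g y))\<^sup>2))"
      by (auto intro!: AE_I2 * simp: norm_mult)
  qed measurable
  have "(\<integral>y. kernel_op M R f y * cnj (g y) \<partial>M) = (\<integral>y. \<integral>x. ?F (x, y) \<partial>M \<partial>M)"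
    unfolding kernel_op_def
    by (intro Bochner_Integration.integral_cong refl)
       (simp flip: integral_mult_left_zero)
  also have "\<dots> = (\<integral>x. \<integral>y. ?F (x, y) \<partial>M \<partial>M)"
    using P.Fubini_integral[of "\<lambda>x y. ?F (x, y)"] F by (simp add: case_prod_beta)
  also have "\<dots> = (\<integral>x. f x * cnj (kernel_op_adj M R g x) \<partial>M)"
    unfolding kernel_op_adj_def Bochner_Integration.integral_cnj[symmetric]
      integral_mult_right_zero[symmetric]
    by (simp add: scaleR_conv_of_real mult.left_commute del: Bochner_Integration.integral_cnj)
  finally show ?thesis .
qed

text \<open>\<open>\<zeta>\<close> lies in the resolvent set when \<open>T - \<zeta>\<close> is a bijection of (the a.e.-classes of)
  \<open>L2 M\<close> with bounded inverse.\<close>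

definition resolvent_set :: "'a measure \<Rightarrow> (('a \<Rightarrow> complex) \<Rightarrow> 'a \<Rightarrow> complex) \<Rightarrow> complex set" where
  "resolvent_set M T = {\<zeta>.
     (\<forall>f\<in>L2 M. (AE x in M. T f x - \<zeta> * f x = 0) \<longrightarrow> (AE x in M. f x = 0)) \<and>
     (\<exists>K. \<forall>g\<in>L2 M. \<exists>f\<in>L2 M. (AE x in M. T f x - \<zeta> * f x = g x) \<and> L2_norm M f \<le> K * L2_norm M g)}"

definition op_spectrum :: "'a measure \<Rightarrow> (('a \<Rightarrow> complex) \<Rightarrow> 'a \<Rightarrow> complex) \<Rightarrow> complex set" where
  "op_spectrum M T = - resolvent_set M T"

definition op_spectral_radius :: "'a measure \<Rightarrow> (('a \<Rightarrow> complex) \<Rightarrow> 'a \<Rightarrow> complex) \<Rightarrow> real" where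
  "op_spectral_radius M T = (SUP z\<in>op_spectrum M T. cmod z)"

section \<open>Path densities and the stationary process\<close>

definition path_weight ::
  "('a \<Rightarrow> 'a \<Rightarrow> real) \<Rightarrow> ('a \<Rightarrow> real) \<Rightarrow> ('a \<Rightarrow> real) \<Rightarrow> int \<Rightarrow> int \<Rightarrow> (int \<Rightarrow> 'a) \<Rightarrow> real" where
  "path_weight R u w a b x = u (x a) * (\<Prod>i\<in>{a+1..b}. R (x (i - 1)) (x i)) * w (x b)"

text \<open>A Perron--Frobenius triple: \<open>r\<close> is the (positive) spectral radius of the operator \<open>T\<close>, and
  \<open>v\<close>, \<open>w\<close> are a.e. positive eigenfunctions of \<open>T\<close> and its adjoint, jointly normalised.\<close>

definition perron_triple ::
  "'a measure \<Rightarrow> ('a \<Rightarrow> 'a \<Rightarrow> real) \<Rightarrow> real \<Rightarrow> ('a \<Rightarrow> real) \<Rightarrow> ('a \<Rightarrow> real) \<Rightarrow> bool" where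
  "perron_triple M R r v w \<longleftrightarrow>
     r = op_spectral_radius M (kernel_op M R) \<and> 0 < r \<and>
     v \<in> L2 M \<and> (AE x in M. 0 < v x) \<and> (AE y in M. kernel_op M R v y = r * v y) \<and>
     w \<in> L2 M \<and> (AE x in M. 0 < w x) \<and> (AE x in M. kernel_op_adj M R w x = r * w x) \<and>
     (\<integral>x. v x * w x \<partial>M) = 1"

definition strictly_stationary :: "'w measure \<Rightarrow> 'a measure \<Rightarrow> (int \<Rightarrow> 'w \<Rightarrow> 'a) \<Rightarrow> bool" where
  "strictly_stationary P M X \<longleftrightarrow>
     (\<forall>t. X t \<in> measurable P M) \<and>
     (\<forall>J k. finite J \<longrightarrow>
        distr P (PiM J (\<lambda>_. M)) (\<lambda>\<omega>. \<lambda>t\<in>J. X (t + k) \<omega>) =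
        distr P (PiM J (\<lambda>_. M)) (\<lambda>\<omega>. \<lambda>t\<in>J. X t \<omega>))"

text \<open>Stationarity and the window densities determine all finite-dimensional laws.
  By uniqueness of the normalised eigenfunctions up to \<open>(c v, w / c)\<close>, the densities do not
  depend on the choice of \<open>v\<close> and \<open>w\<close>.\<close>

definition CEStGM_process ::
  "'a measure \<Rightarrow> ('a \<Rightarrow> 'a \<Rightarrow> real) \<Rightarrow> 'w measure \<Rightarrow> (int \<Rightarrow> 'w \<Rightarrow> 'a) \<Rightarrow> bool" where
  "CEStGM_process M R P X \<longleftrightarrow>
     prob_space P \<and> strictly_stationary P M X \<and>
     (\<exists>r v w. perron_triple M R r v w \<and>
        (\<forall>n::nat. distributed P (PiM {0..int n + 1} (\<lambda>_. M)) (\<lambda>\<omega>. \<lambda>t\<in>{0..int n + 1}. X t \<omega>)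
           (\<lambda>x. ennreal (path_weight R v w 0 (int n + 1) x / r ^ (n + 1)))))"

section \<open>The finite-volume densities\<close>

definition chain_const :: "'a measure \<Rightarrow> ('a \<Rightarrow> 'a \<Rightarrow> real) \<Rightarrow> ('a \<Rightarrow> real) \<Rightarrow> nat \<Rightarrow> nat \<Rightarrow> real" where
  "chain_const M R f n m =
     (\<integral>x. path_weight R f f (1 - int m) (int n + int m) x \<partial>PiM {1 - int m..int n + int m} (\<lambda>_. M))"

definition chain_density ::
  "'a measure \<Rightarrow> ('a \<Rightarrow> 'a \<Rightarrow> real) \<Rightarrow> ('a \<Rightarrow> real) \<Rightarrow> nat \<Rightarrow> nat \<Rightarrow> (int \<Rightarrow> 'a) \<Rightarrow> real" where
  "chain_density M R f n m x =
     path_weight R f f (1 - int m) (int n + int m) x / chain_const M R f n m"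

definition outer_indices :: "nat \<Rightarrow> nat \<Rightarrow> int set" where
  "outer_indices n m = {1 - int m..-1} \<union> {int n + 2..int n + int m}"

definition chain_marginal ::
  "'a measure \<Rightarrow> ('a \<Rightarrow> 'a \<Rightarrow> real) \<Rightarrow> ('a \<Rightarrow> real) \<Rightarrow> nat \<Rightarrow> nat \<Rightarrow> (int \<Rightarrow> 'a) \<Rightarrow> real" where
  "chain_marginal M R f n m x =
     (\<integral>z. chain_density M R f n m (merge {0..int n + 1} (outer_indices n m) (x, z))
        \<partial>PiM (outer_indices n m) (\<lambda>_. M))"

definition tv_dist :: "'a measure \<Rightarrow> 'a measure \<Rightarrow> real" where
  "tv_dist M N = (SUP A\<in>sets M. \<bar>measure M A - measure N A\<bar>)"

end

theory Submission
  imports Defs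
begin

text \<open>
  After division by \<open>r\<close> the kernel \<open>K\<close> has eigenfunctions \<open>v\<close>, \<open>w\<close> for the eigenvalue 1. Since
  \<open>v\<close>, \<open>w\<close> and \<open>K\<close> are positive, \<open>(K - n w \<otimes> v)\<^sup>+\<close> and \<open>(w \<otimes> v - n K)\<^sup>+\<close> tend to zero in
  Hilbert--Schmidt norm as \<open>n\<close> grows. The first fact gives a Lasota--Yorke inequality
  \<open>\<parallel>T g\<parallel>\<^sub>2 \<le> C |g| + \<parallel>g\<parallel>\<^sub>2 / 4\<close> for the weighted norm \<open>|g| = \<integral>|g| w\<close>; the second gives
  \<open>|T g| \<le> (1 - t) |g| + t e \<parallel>g\<parallel>\<^sub>2\<close> on the complement \<open>\<langle>g, w\<rangle> = 0\<close>, with \<open>e\<close> as small as desired.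
  Hence \<open>T\<close> contracts \<open>|g| + \<delta> \<parallel>g\<parallel>\<^sub>2\<close> on the complement for a suitable \<open>\<delta>\<close>, so that
  \<open>T\<^sup>k f \<rightarrow> \<langle>f, w\<rangle> v\<close> at a geometric rate without any appeal to spectral theory; the same holds
  for the transposed kernel. The window marginal has density proportional to
  \<open>(T\<^sup>k f)(x\<^sub>0) \<Prod>K(x\<^sub>i\<^sub>-\<^sub>1, x\<^sub>i) (T\<^sup>*\<^sup>k f)(x\<^sub>N)\<close> with \<open>k = m - 1\<close>, and power boundedness of \<open>T\<close> makes
  the estimate uniform in the length of the window.
\<close>

section \<open>Square-integrable functions\<close>

lemma L2_real_iff:
  fixes f :: "'a \<Rightarrow> real"
  shows "f \<in> L2 M \<longleftrightarrow> f \<in> borel_measurable M \<and> integrable M (\<lambda>x. (f x)\<^sup>2)"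
  by (simp add: L2_def)

lemma L2_measurable [measurable_dest]: "f \<in> L2 M \<Longrightarrow> f \<in> borel_measurable M"
  by (simp add: L2_def)

lemma L2_norm_nonneg [simp]: "0 \<le> L2_norm M f"
  by (simp add: L2_norm_def)

lemma L2_norm_power2:
  fixes f :: "'a \<Rightarrow> real"
  shows "(L2_norm M f)\<^sup>2 = (\<integral>x. (f x)\<^sup>2 \<partial>M)"
  by (simp add: L2_norm_def)

lemma L2_abs [simp]:
  fixes f :: "'a \<Rightarrow> real"
  assumes "f \<in> L2 M" shows "(\<lambda>x. \<bar>f x\<bar>) \<in> L2 M"
  using assms by (auto simp: L2_def)

lemma L2_norm_abs [simp]:
  fixes f :: "'a \<Rightarrow> real"
  shows "L2_norm M (\<lambda>x. \<bar>f x\<bar>) = L2_norm M f"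
  by (simp add: L2_norm_def)

lemma L2_cmult:
  fixes f :: "'a \<Rightarrow> real"
  assumes "f \<in> L2 M" shows "(\<lambda>x. c * f x) \<in> L2 M"
  using assms by (auto simp: L2_real_iff power_mult_distrib)

lemma L2_norm_cmult:
  fixes f :: "'a \<Rightarrow> real"
  shows "L2_norm M (\<lambda>x. c * f x) = \<bar>c\<bar> * L2_norm M f"
  by (simp add: L2_norm_def power_mult_distrib abs_mult real_sqrt_mult)

lemma L2_integrable_mult:
  fixes f g :: "'a \<Rightarrow> real"
  assumes "f \<in> L2 M" "g \<in> L2 M"
  shows "integrable M (\<lambda>x. f x * g x)"
proof (rule Bochner_Integration.integrable_bound)
  show "integrable M (\<lambda>x. (f x)\<^sup>2 + (g x)\<^sup>2)"
    using assms by (auto simp: L2_real_iff)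
  have "\<bar>a * b\<bar> \<le> a\<^sup>2 + b\<^sup>2" for a b :: real
  proof -
    have "2 * (\<bar>a\<bar> * \<bar>b\<bar>) \<le> a\<^sup>2 + b\<^sup>2"
      using sum_squares_bound[of "\<bar>a\<bar>" "\<bar>b\<bar>"] by (simp add: mult.assoc)
    moreover have "0 \<le> \<bar>a\<bar> * \<bar>b\<bar>" by simp
    ultimately show ?thesis unfolding abs_mult by linarith
  qed
  then show "AE x in M. norm (f x * g x) \<le> norm ((f x)\<^sup>2 + (g x)\<^sup>2)" by auto
qed (use assms in \<open>measurable\<close>)

lemma L2_add:
  fixes f g :: "'a \<Rightarrow> real"
  assumes "f \<in> L2 M" "g \<in> L2 M"
  shows "(\<lambda>x. f x + g x) \<in> L2 M"
  using assms L2_integrable_mult[OF assms]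
  by (auto simp: L2_real_iff power2_sum mult.assoc)

lemma L2_diff:
  fixes f g :: "'a \<Rightarrow> real"
  assumes "f \<in> L2 M" "g \<in> L2 M"
  shows "(\<lambda>x. f x - g x) \<in> L2 M"
  using assms L2_integrable_mult[OF assms]
  by (auto simp: L2_real_iff power2_diff mult.assoc)

lemma L2_bound:
  fixes f g :: "'a \<Rightarrow> real"
  assumes "g \<in> L2 M" "f \<in> borel_measurable M" "AE x in M. \<bar>f x\<bar> \<le> g x"
  shows "f \<in> L2 M" "L2_norm M f \<le> L2_norm M g"
proof -
  have le: "AE x in M. (f x)\<^sup>2 \<le> (g x)\<^sup>2"
    using assms(3) by eventually_elim (simp add: abs_le_square_iff[symmetric])
  show *: "f \<in> L2 M"
    unfolding L2_real_iff
  proof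
    show "integrable M (\<lambda>x. (f x)\<^sup>2)"
      by (rule Bochner_Integration.integrable_bound[where f = "\<lambda>x. (g x)\<^sup>2"])
         (use assms le in \<open>auto simp: L2_real_iff\<close>)
  qed fact
  show "L2_norm M f \<le> L2_norm M g"
    unfolding L2_norm_def using * assms le
    by (auto simp: L2_real_iff intro!: integral_mono_AE)
qed

lemma L2_norm_cong_AE:
  fixes f g :: "'a \<Rightarrow> real"
  assumes "f \<in> L2 M" "g \<in> L2 M" "AE x in M. f x = g x"
  shows "L2_norm M f = L2_norm M g"
  unfolding L2_norm_def using assms
  by (auto intro!: arg_cong[where f = sqrt] integral_cong_AE)

lemma L2_Cauchy_Schwarz_abs:
  fixes f g :: "'a \<Rightarrow> real"
  assumes "f \<in> L2 M" "g \<in> L2 M"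
  shows "(\<integral>x. \<bar>f x * g x\<bar> \<partial>M) \<le> L2_norm M f * L2_norm M g"
proof -
  let ?F = "\<lambda>h x. ennreal \<bar>h x :: real\<bar>"
  have [measurable]: "f \<in> borel_measurable M" "g \<in> borel_measurable M"
    using assms by (auto simp: L2_def)
  have sq: "(\<integral>\<^sup>+x. (?F h x)\<^sup>2 \<partial>M) = ennreal ((L2_norm M h)\<^sup>2)" if "h \<in> L2 M" for h
    unfolding L2_norm_power2 using that
    by (subst nn_integral_eq_integral[symmetric]) (auto simp: L2_real_iff ennreal_power)
  have "(\<integral>\<^sup>+x. ?F f x * ?F g x \<partial>M) = ennreal (\<integral>x. \<bar>f x * g x\<bar> \<partial>M)"
    using integrable_abs[OF L2_integrable_mult[OF assms]]
    by (subst nn_integral_eq_integral[symmetric]) (auto simp: ennreal_mult abs_mult)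
  then have "(ennreal (\<integral>x. \<bar>f x * g x\<bar> \<partial>M))\<^sup>2 \<le> ennreal ((L2_norm M f)\<^sup>2) * ennreal ((L2_norm M g)\<^sup>2)"
    using Cauchy_Schwarz_nn_integral[of "?F f" M "?F g"] assms by (simp add: sq)
  then have "(\<integral>x. \<bar>f x * g x\<bar> \<partial>M)\<^sup>2 \<le> (L2_norm M f * L2_norm M g)\<^sup>2"
    by (simp add: ennreal_power power_mult_distrib flip: ennreal_mult)
  then show ?thesis
    by (rule power2_le_imp_le) simp
qed

lemma L2_Cauchy_Schwarz:
  fixes f g :: "'a \<Rightarrow> real"
  assumes "f \<in> L2 M" "g \<in> L2 M"
  shows "\<bar>\<integral>x. f x * g x \<partial>M\<bar> \<le> L2_norm M f * L2_norm M g"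
  using integral_abs_bound[of M "\<lambda>x. f x * g x"] L2_Cauchy_Schwarz_abs[OF assms] by linarith

lemma L2_norm_triangle:
  fixes f g :: "'a \<Rightarrow> real"
  assumes "f \<in> L2 M" "g \<in> L2 M"
  shows "L2_norm M (\<lambda>x. f x + g x) \<le> L2_norm M f + L2_norm M g"
proof (rule power2_le_imp_le)
  have i: "integrable M (\<lambda>x. (f x)\<^sup>2)" "integrable M (\<lambda>x. (g x)\<^sup>2)" "integrable M (\<lambda>x. f x * g x)"
    using assms L2_integrable_mult by (auto simp: L2_real_iff)
  have "(L2_norm M (\<lambda>x. f x + g x))\<^sup>2 = (L2_norm M f)\<^sup>2 + (L2_norm M g)\<^sup>2 + 2 * (\<integral>x. f x * g x \<partial>M)"
    using i by (simp add: L2_norm_power2 power2_sum mult.assoc)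
  also have "\<dots> \<le> (L2_norm M f + L2_norm M g)\<^sup>2"
    using L2_Cauchy_Schwarz[OF assms] by (simp add: power2_sum)
  finally show "(L2_norm M (\<lambda>x. f x + g x))\<^sup>2 \<le> (L2_norm M f + L2_norm M g)\<^sup>2" .
qed simp

lemma L2_norm_triangle_diff:
  fixes f g :: "'a \<Rightarrow> real"
  assumes "f \<in> L2 M" "g \<in> L2 M"
  shows "L2_norm M (\<lambda>x. f x - g x) \<le> L2_norm M f + L2_norm M g"
  using L2_norm_triangle[OF assms(1) L2_cmult[OF assms(2), of "-1"]] L2_norm_cmult[of M "-1" g]
  by simp

text \<open>At a point where \<open>F\<close> is positive the excess of \<open>G\<close> over
  \<open>n F\<close> vanishes once \<open>n \<ge> G / F\<close>, and it never exceeds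
  \<open>G\<close>; dominated convergence for the squares does the rest. This replaces a pointwise
  bound of \<open>G\<close> by a multiple of \<open>F\<close>, which in general does not
  exist.\<close>

lemma L2_excess_tendsto_zero:
  fixes F G :: "'a \<Rightarrow> real"
  assumes F: "F \<in> borel_measurable M" "AE x in M. 0 < F x" and G: "G \<in> L2 M" "AE x in M. 0 \<le> G x"
  shows "(\<lambda>x. max 0 (G x - real n * F x)) \<in> L2 M"
    and "(\<lambda>n. L2_norm M (\<lambda>x. max 0 (G x - real n * F x))) \<longlonglongrightarrow> 0"
proof -
  let ?E = "\<lambda>n x. max 0 (G x - real n * F x)"
  have [measurable]: "G \<in> borel_measurable M" "F \<in> borel_measurable M"
    using F G by (auto simp: L2_def)
  have le: "AE x in M. \<bar>?E n x\<bar> \<le> G x" for n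
    using F(2) G(2) by eventually_elim auto
  show "?E n \<in> L2 M" for n
    by (rule L2_bound[OF G(1) _ le]) measurable
  have "(\<lambda>n. \<integral>x. (?E n x)\<^sup>2 \<partial>M) \<longlonglongrightarrow> (\<integral>x. 0 \<partial>M)"
  proof (rule integral_dominated_convergence)
    show "integrable M (\<lambda>x. (G x)\<^sup>2)" using G by (simp add: L2_real_iff)
    show "AE x in M. (\<lambda>n. (?E n x)\<^sup>2) \<longlonglongrightarrow> 0"
      using F(2)
    proof eventually_elim
      case (elim x)
      obtain n0 :: nat where "G x / F x \<le> n0" using real_arch_simple by blast
      then have "G x \<le> real n * F x" if "n0 \<le> n" for n
      proof -
        have "G x / F x \<le> real n" using \<open>G x / F x \<le> n0\<close> that by linarith
        then show ?thesis using elim by (simp add: field_simps)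
      qed
      then have "eventually (\<lambda>n. (?E n x)\<^sup>2 = 0) sequentially"
        by (auto simp: eventually_sequentially intro!: exI[of _ n0])
      then show ?case by (rule tendsto_eventually)
    qed
    show "AE x in M. norm ((?E n x)\<^sup>2) \<le> (G x)\<^sup>2" for n
      using le[of n] by eventually_elim (simp add: abs_le_square_iff[symmetric])
  qed measurable
  then have "(\<lambda>n. sqrt (\<integral>x. (?E n x)\<^sup>2 \<partial>M)) \<longlonglongrightarrow> sqrt 0"
    by (intro tendsto_real_sqrt) simp
  then show "(\<lambda>n. L2_norm M (?E n)) \<longlonglongrightarrow> 0"
    by (simp add: L2_norm_def)
qed

section \<open>Hilbert--Schmidt operators\<close>

definition hs_norm :: "'a measure \<Rightarrow> ('a \<Rightarrow> 'a \<Rightarrow> real) \<Rightarrow> real" where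
  "hs_norm M K = L2_norm (M \<Otimes>\<^sub>M M) (\<lambda>(x, y). K x y)"

lemma kernel_op_adj_transpose: "kernel_op_adj M K = kernel_op M (\<lambda>x y. K y x)"
  by (simp add: kernel_op_adj_def kernel_op_def fun_eq_iff)

lemma kernel_op_cmult:
  fixes g :: "'a \<Rightarrow> real"
  shows "kernel_op M K (\<lambda>x. c * g x) = (\<lambda>y. c * kernel_op M K g y)"
proof
  fix y
  show "kernel_op M K (\<lambda>x. c * g x) y = c * kernel_op M K g y"
    by (simp add: kernel_op_def mult.left_commute flip: integral_mult_right_zero)
qed

lemma kernel_op_nonneg:
  fixes g :: "'a \<Rightarrow> real"
  assumes "\<And>x y. 0 \<le> K x y" "AE x in M. 0 \<le> g x"
  shows "0 \<le> kernel_op M K g y"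
  unfolding kernel_op_def
  by (rule integral_nonneg_AE) (use assms(2) in \<open>eventually_elim, simp add: assms(1)\<close>)

lemma L2_prod:
  fixes f g :: "'a \<Rightarrow> real"
  assumes "sigma_finite_measure M" and f: "f \<in> L2 M" and g: "g \<in> L2 M"
  shows "(\<lambda>(x, y). f x * g y) \<in> L2 (M \<Otimes>\<^sub>M M)"
proof -
  interpret sigma_finite_measure M by fact
  interpret pair: pair_sigma_finite M M ..
  have [measurable]: "f \<in> borel_measurable M" "g \<in> borel_measurable M"
    and i: "integrable M (\<lambda>x. (f x)\<^sup>2)" "integrable M (\<lambda>x. (g x)\<^sup>2)"
    using f g by (auto simp: L2_real_iff)
  have "integrable (M \<Otimes>\<^sub>M M) (\<lambda>(x, y). (f x)\<^sup>2 * (g y)\<^sup>2)"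
  proof (rule pair.Fubini_integrable)
    show "integrable M (\<lambda>x. \<integral>y. norm (case (x, y) of (x, y) \<Rightarrow> (f x)\<^sup>2 * (g y)\<^sup>2) \<partial>M)"
      using i by (simp add: abs_mult)
  qed (use i in auto)
  then show ?thesis by (simp add: L2_real_iff case_prod_beta' power_mult_distrib)
qed

locale hs_kernel = sigma_finite_measure M for M :: "'a measure" +
  fixes K :: "'a \<Rightarrow> 'a \<Rightarrow> real"
  assumes kernel_L2: "(\<lambda>(x, y). K x y) \<in> L2 (M \<Otimes>\<^sub>M M)"
begin

sublocale pair: pair_sigma_finite M M ..

lemma kernel_measurable [measurable]: "(\<lambda>(x, y). K x y) \<in> borel_measurable (M \<Otimes>\<^sub>M M)"
  using kernel_L2 by (simp add: L2_def)

lemma kernel_integrable: "integrable (M \<Otimes>\<^sub>M M) (\<lambda>(x, y). (K x y)\<^sup>2)"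
  using kernel_L2 by (simp add: L2_real_iff case_prod_beta')

lemma hs_kernel_transpose: "hs_kernel M (\<lambda>x y. K y x)"
proof
  have "integrable (M \<Otimes>\<^sub>M M) (\<lambda>(x, y). (K y x)\<^sup>2)"
    using kernel_integrable by (subst pair.integrable_product_swap_iff[symmetric]) (simp add: case_prod_beta')
  then show "(\<lambda>(x, y). K y x) \<in> L2 (M \<Otimes>\<^sub>M M)"
    by (simp add: L2_real_iff case_prod_beta')
qed

lemma slice_measurable: "y \<in> space M \<Longrightarrow> (\<lambda>x. K x y) \<in> borel_measurable M"
  by measurable

text \<open>Fubini for the squared kernel. For the remaining null set of \<open>y\<close> the
  integral in \<open>kernel_op\<close> may take the Bochner default value 0, so additivity of
  \<open>kernel_op\<close> is stated only almost everywhere.\<close>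

lemma AE_slice_L2: "AE y in M. (\<lambda>x. K x y) \<in> L2 M"
  using pair.AE_integrable_snd[OF kernel_integrable] AE_space
  by eventually_elim (simp add: L2_real_iff slice_measurable)

lemma AE_kernel_integrable:
  assumes "g \<in> L2 M"
  shows "AE y in M. integrable M (\<lambda>x. K x y * g x)"
  using AE_slice_L2 by eventually_elim (rule L2_integrable_mult[OF _ assms])

lemma kernel_op_measurable [measurable]:
  assumes [measurable]: "g \<in> borel_measurable M"
  shows "kernel_op M K g \<in> borel_measurable M"
  unfolding kernel_op_def by measurable

text \<open>Cauchy-Schwarz on each slice, then integration over \<open>y\<close>: the
  Hilbert-Schmidt norm dominates the operator norm. Smallness of an operator is always obtained
  through this bound.\<close>

lemma kernel_op_L2:
  fixes g :: "'a \<Rightarrow> real"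
  assumes g: "g \<in> L2 M"
  shows "kernel_op M K g \<in> L2 M"
    and "L2_norm M (kernel_op M K g) \<le> hs_norm M K * L2_norm M g"
proof -
  have [measurable]: "g \<in> borel_measurable M" using g by (simp add: L2_def)
  let ?h = "\<lambda>y. (\<integral>x. (K x y)\<^sup>2 \<partial>M) * (L2_norm M g)\<^sup>2"
  have i: "integrable M ?h"
    using pair.integrable_snd[OF kernel_integrable] by simp
  have le: "AE y in M. (kernel_op M K g y)\<^sup>2 \<le> ?h y"
    using AE_slice_L2
  proof eventually_elim
    case (elim y)
    have "\<bar>kernel_op M K g y\<bar> \<le> L2_norm M (\<lambda>x. K x y) * L2_norm M g"
      using L2_Cauchy_Schwarz[OF elim g] by (simp add: kernel_op_def)
    then have "\<bar>kernel_op M K g y\<bar>\<^sup>2 \<le> (L2_norm M (\<lambda>x. K x y) * L2_norm M g)\<^sup>2"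
      by (intro power_mono) auto
    then show ?case
      by (simp add: power_mult_distrib L2_norm_power2)
  qed
  have i2: "integrable M (\<lambda>y. (kernel_op M K g y)\<^sup>2)"
    by (rule Bochner_Integration.integrable_bound[OF i]) (use le in \<open>auto elim!: eventually_mono\<close>)
  then show *: "kernel_op M K g \<in> L2 M"
    by (simp add: L2_real_iff)
  have "(\<integral>y. \<integral>x. (K x y)\<^sup>2 \<partial>M \<partial>M) = (hs_norm M K)\<^sup>2"
    unfolding hs_norm_def L2_norm_power2 using pair.integral_snd[OF kernel_integrable]
    by (simp add: case_prod_beta')
  then have "(L2_norm M (kernel_op M K g))\<^sup>2 \<le> (hs_norm M K * L2_norm M g)\<^sup>2"
    using integral_mono_AE[OF i2 i le] by (simp add: L2_norm_power2 power_mult_distrib)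
  then show "L2_norm M (kernel_op M K g) \<le> hs_norm M K * L2_norm M g"
    by (rule power2_le_imp_le) (simp add: hs_norm_def)
qed

lemma kernel_op_funpow_L2:
  fixes g :: "'a \<Rightarrow> real"
  assumes "g \<in> L2 M"
  shows "(kernel_op M K ^^ k) g \<in> L2 M"
  by (induction k) (auto intro: assms kernel_op_L2)

lemma kernel_op_cong_AE:
  fixes g h :: "'a \<Rightarrow> real"
  assumes [measurable]: "g \<in> borel_measurable M" "h \<in> borel_measurable M"
    and eq: "AE x in M. g x = h x"
  shows "AE y in M. kernel_op M K g y = kernel_op M K h y"
  using AE_space
proof eventually_elim
  case (elim y)
  note slice_measurable[OF elim, measurable]
  show ?case
    unfolding kernel_op_def using eq by (intro integral_cong_AE) auto
qed

lemma kernel_op_diff: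
  fixes g h :: "'a \<Rightarrow> real"
  assumes "g \<in> L2 M" "h \<in> L2 M"
  shows "AE y in M. kernel_op M K (\<lambda>x. g x - h x) y = kernel_op M K g y - kernel_op M K h y"
  using AE_kernel_integrable[OF assms(1)] AE_kernel_integrable[OF assms(2)]
  by eventually_elim (simp add: kernel_op_def algebra_simps)

lemma kernel_op_abs_le:
  fixes g :: "'a \<Rightarrow> real"
  assumes "\<And>x y. 0 \<le> K x y"
  shows "\<bar>kernel_op M K g y\<bar> \<le> kernel_op M K (\<lambda>x. \<bar>g x\<bar>) y"
  using integral_abs_bound[of M "\<lambda>x. K x y * g x"] assms
  by (simp add: kernel_op_def abs_mult)

text \<open>Real counterpart of \<open>kernel_op_adjoint\<close>. Fubini applies because the
  integrand is a product of two square-integrable functions on the product space, the kernel and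
  \<open>f x * g y\<close>.\<close>

lemma kernel_op_inner:
  fixes f g :: "'a \<Rightarrow> real"
  assumes f: "f \<in> L2 M" and g: "g \<in> L2 M"
  shows "(\<integral>y. kernel_op M K f y * g y \<partial>M) = (\<integral>x. f x * kernel_op_adj M K g x \<partial>M)"
proof -
  have [measurable]: "f \<in> borel_measurable M" "g \<in> borel_measurable M"
    and i: "integrable M (\<lambda>x. (f x)\<^sup>2)" "integrable M (\<lambda>x. (g x)\<^sup>2)"
    using f g by (auto simp: L2_real_iff)
  from L2_integrable_mult[OF kernel_L2 L2_prod[OF sigma_finite_measure_axioms f g]]
  have F: "integrable (M \<Otimes>\<^sub>M M) (\<lambda>(x, y). K x y * (f x * g y))"
    by (simp add: case_prod_beta')
  have "(\<integral>y. kernel_op M K f y * g y \<partial>M) = (\<integral>y. \<integral>x. K x y * (f x * g y) \<partial>M \<partial>M)"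
    unfolding kernel_op_def
    by (intro Bochner_Integration.integral_cong refl)
       (simp add: mult.assoc flip: integral_mult_left_zero)
  also have "\<dots> = (\<integral>x. \<integral>y. K x y * (f x * g y) \<partial>M \<partial>M)"
    by (rule pair.Fubini_integral[OF F])
  also have "\<dots> = (\<integral>x. f x * kernel_op_adj M K g x \<partial>M)"
    unfolding kernel_op_adj_def
    by (intro Bochner_Integration.integral_cong refl)
       (simp add: mult.left_commute flip: integral_mult_right_zero)
  finally show ?thesis .
qed

end

section \<open>Spectral gap of a positive kernel\<close>

text \<open>The kernel is normalised to eigenvalue 1. The assumptions are symmetric under
  transposing \<open>K\<close> and exchanging \<open>v\<close> with \<open>w\<close>, so every
  result below also holds for the adjoint operator.\<close>

locale perron_kernel = hs_kernel M K for M :: "'a measure" and K +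
  fixes v w :: "'a \<Rightarrow> real"
  assumes kernel_pos: "0 < K x y"
    and right_L2: "v \<in> L2 M" and right_pos: "AE x in M. 0 < v x"
    and left_L2: "w \<in> L2 M" and left_pos: "AE x in M. 0 < w x"
    and right_eigen: "AE y in M. kernel_op M K v y = v y"
    and left_eigen: "AE x in M. kernel_op_adj M K w x = w x"
    and normalised: "(\<integral>x. v x * w x \<partial>M) = 1"
begin

lemma perron_kernel_transpose: "perron_kernel M (\<lambda>x y. K y x) w v"
proof (intro perron_kernel.intro perron_kernel_axioms.intro hs_kernel_transpose)
  show "AE y in M. kernel_op M (\<lambda>x y. K y x) w y = w y"
    using left_eigen by (simp add: kernel_op_adj_transpose)
  show "AE x in M. kernel_op_adj M (\<lambda>x y. K y x) v x = v x"
    using right_eigen by (simp add: kernel_op_adj_transpose)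
  show "(\<integral>x. w x * v x \<partial>M) = 1"
    using normalised by (simp add: mult.commute)
qed (fact kernel_pos right_L2 right_pos left_L2 left_pos)+

lemma kernel_nonneg: "0 \<le> K x y"
  using kernel_pos[of x y] by simp

lemmas eigen_measurable [measurable] = L2_measurable[OF right_L2] L2_measurable[OF left_L2]

text \<open>The weight is the left eigenfunction, so the operator preserves this norm on nonnegative
  functions and, the kernel being positive, does not increase it on any function in
  \<open>L2 M\<close>.\<close>

definition wnorm :: "('a \<Rightarrow> real) \<Rightarrow> real" where
  "wnorm g = (\<integral>x. \<bar>g x\<bar> * w x \<partial>M)"

lemma wnorm_nonneg: "0 \<le> wnorm g"
  unfolding wnorm_def by (rule integral_nonneg_AE) (use left_pos in \<open>eventually_elim, simp\<close>)

lemma wnorm_le: "g \<in> L2 M \<Longrightarrow> wnorm g \<le> L2_norm M w * L2_norm M g"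
  using L2_Cauchy_Schwarz[of "\<lambda>x. \<bar>g x\<bar>" M w] left_L2
  by (simp add: wnorm_def mult.commute)

text \<open>Move the operator onto \<open>w\<close>, which its adjoint fixes. In particular the
  complement, where the pairing with \<open>w\<close> vanishes, is invariant.\<close>

lemma inner_kernel_op:
  assumes "g \<in> L2 M"
  shows "(\<integral>x. kernel_op M K g x * w x \<partial>M) = (\<integral>x. g x * w x \<partial>M)"
proof -
  interpret T: hs_kernel M "\<lambda>x y. K y x" by (rule hs_kernel_transpose)
  have [measurable]: "g \<in> borel_measurable M" "kernel_op_adj M K w \<in> borel_measurable M"
    using assms by (auto simp: L2_def kernel_op_adj_transpose)
  show ?thesis
    unfolding kernel_op_inner[OF assms left_L2]
    by (intro integral_cong_AE) (use left_eigen in \<open>auto elim!: eventually_mono\<close>)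
qed

section \<open>Two-sided comparison of the kernel with the rank-one kernel
  \<open>w x * v y\<close>\<close>

lemma AE_eigen_product_pos: "AE z in M \<Otimes>\<^sub>M M. 0 < (case z of (x, y) \<Rightarrow> w x * v y)"
proof (rule pair.AE_pair_measure)
  show "AE x in M. AE y in M. 0 < (case (x, y) of (x, y) \<Rightarrow> w x * v y)"
    using left_pos
  proof eventually_elim
    case (elim x)
    show ?case using right_pos by eventually_elim (simp add: elim)
  qed
qed measurable

lemma eigen_product_L2: "(\<lambda>(x, y). w x * v y) \<in> L2 (M \<Otimes>\<^sub>M M)"
  by (rule L2_prod[OF sigma_finite_measure_axioms left_L2 right_L2])

text \<open>\<open>L2_excess_tendsto_zero\<close> on the product space. It is used in both
  directions: once with the rank-one kernel as \<open>F\<close> and \<open>K\<close> as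
  \<open>G\<close>, once with the roles exchanged.\<close>

lemma hs_norm_excess_tendsto_zero:
  fixes F G :: "'a \<Rightarrow> 'a \<Rightarrow> real"
  assumes E_def: "E = (\<lambda>n x y. max 0 (G x y - real n * F x y))"
    and F: "(\<lambda>(x, y). F x y) \<in> borel_measurable (M \<Otimes>\<^sub>M M)" "AE z in M \<Otimes>\<^sub>M M. 0 < (case z of (x, y) \<Rightarrow> F x y)"
    and G: "(\<lambda>(x, y). G x y) \<in> L2 (M \<Otimes>\<^sub>M M)" "AE z in M \<Otimes>\<^sub>M M. 0 < (case z of (x, y) \<Rightarrow> G x y)"
  shows "hs_kernel M (E n)" and "(\<lambda>n. hs_norm M (E n)) \<longlonglongrightarrow> 0"
proof -
  have "AE z in M \<Otimes>\<^sub>M M. 0 \<le> (case z of (x, y) \<Rightarrow> G x y)"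
    using G(2) by eventually_elim auto
  note * = L2_excess_tendsto_zero[OF F G(1) this]
  have eq: "(\<lambda>z. max 0 ((case z of (x, y) \<Rightarrow> G x y) - real n * (case z of (x, y) \<Rightarrow> F x y))) = (\<lambda>(x, y). E n x y)" for n
    by (auto simp: E_def)
  show "hs_kernel M (E n)"
    using *(1)[of n] unfolding eq by (simp add: hs_kernel_def hs_kernel_axioms_def sigma_finite_measure_axioms)
  show "(\<lambda>n. hs_norm M (E n)) \<longlonglongrightarrow> 0"
    using *(2) unfolding eq by (simp add: hs_norm_def)
qed

text \<open>Bound \<open>K\<close> by \<open>n\<close> times the rank-one kernel plus the excess
  \<open>B n\<close>. The rank-one part sees \<open>g\<close> only through \<open>wnorm g\<close>
  and contributes a multiple of \<open>v\<close>; the excess has Hilbert-Schmidt norm below 1/4 for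
  a suitable \<open>n\<close>.\<close>

lemma Lasota_Yorke:
  obtains C where "0 < C"
    "\<And>g. g \<in> L2 M \<Longrightarrow> L2_norm M (kernel_op M K g) \<le> C * wnorm g + 1/4 * L2_norm M g"
proof -
  define B where "B = (\<lambda>n x y. max 0 (K x y - real n * (w x * v y)))"
  have KP: "AE z in M \<Otimes>\<^sub>M M. 0 < (case z of (x, y) \<Rightarrow> K x y)"
    using kernel_pos by (auto intro!: AE_I2)
  note B = hs_norm_excess_tendsto_zero[OF B_def L2_measurable[OF eigen_product_L2] AE_eigen_product_pos
      kernel_L2 KP]
  obtain n where n: "hs_norm M (B n) < 1/4"
    using order_tendstoD(2)[OF B(2), of "1/4"] by (auto simp: eventually_sequentially)
  interpret B: hs_kernel M "B n" by (rule B(1))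
  have B0: "0 \<le> B n x y" for x y by (simp add: B_def)
  show thesis
  proof
    \<comment> \<open>The summand 1 keeps the constant positive even for \<open>n = 0\<close>; it is
      later a divisor.\<close>
    show "0 < real n * L2_norm M v + 1"
      by (simp add: add_nonneg_pos)
  next
    fix g :: "'a \<Rightarrow> real" assume g: "g \<in> L2 M"
    have le: "AE y in M. \<bar>kernel_op M K g y\<bar> \<le> real n * wnorm g * v y + kernel_op M (B n) (\<lambda>x. \<bar>g x\<bar>) y"
      using AE_kernel_integrable[OF L2_abs[OF g]] B.AE_kernel_integrable[OF L2_abs[OF g]]
    proof eventually_elim
      case (elim y)
      have i: "integrable M (\<lambda>x. \<bar>g x\<bar> * w x)"
        by (rule L2_integrable_mult[OF L2_abs[OF g] left_L2])
      have "kernel_op M K (\<lambda>x. \<bar>g x\<bar>) y = (\<integral>x. K x y * \<bar>g x\<bar> \<partial>M)"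
        by (simp add: kernel_op_def)
      also have "\<dots> \<le> (\<integral>x. real n * v y * (\<bar>g x\<bar> * w x) + B n x y * \<bar>g x\<bar> \<partial>M)"
      proof (rule integral_mono)
        fix x
        have "K x y \<le> real n * v y * w x + B n x y"
          by (simp add: B_def mult_ac)
        from mult_right_mono[OF this abs_ge_zero[of "g x"]]
        show "K x y * \<bar>g x\<bar> \<le> real n * v y * (\<bar>g x\<bar> * w x) + B n x y * \<bar>g x\<bar>"
          by (simp add: algebra_simps)
      qed (use i elim in auto)
      also have "\<dots> = real n * wnorm g * v y + kernel_op M (B n) (\<lambda>x. \<bar>g x\<bar>) y"
        using i elim by (simp add: wnorm_def kernel_op_def)
      finally show ?case
        using kernel_op_abs_le[OF kernel_nonneg, of g y] by linarith
    qed
    note BL = B.kernel_op_L2[OF L2_abs[OF g]]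
    have "L2_norm M (kernel_op M K g)
        \<le> L2_norm M (\<lambda>y. real n * wnorm g * v y + kernel_op M (B n) (\<lambda>x. \<bar>g x\<bar>) y)"
      by (rule L2_bound(2)[OF _ _ le])
         (intro L2_add L2_cmult right_L2 BL(1) L2_measurable kernel_op_L2(1) g)+
    also have "\<dots> \<le> real n * wnorm g * L2_norm M v + hs_norm M (B n) * L2_norm M g"
      using L2_norm_triangle[OF L2_cmult[OF right_L2, of "real n * wnorm g"] BL(1)] BL(2) wnorm_nonneg[of g]
      by (simp add: L2_norm_cmult)
    also have "\<dots> \<le> real n * wnorm g * L2_norm M v + 1/4 * L2_norm M g"
      using n by (intro add_left_mono mult_right_mono) auto
    also have "\<dots> \<le> (real n * L2_norm M v + 1) * wnorm g + 1/4 * L2_norm M g"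
      using wnorm_nonneg[of g] by (simp add: algebra_simps)
    finally show "L2_norm M (kernel_op M K g) \<le> (real n * L2_norm M v + 1) * wnorm g + 1/4 * L2_norm M g" .
  qed
qed

text \<open>A Doeblin argument without a pointwise minorisation: subtracting \<open>t\<close> times
  the rank-one kernel does not change the operator on the complement but lowers the mass of the
  kernel, except where \<open>K\<close> lies below that multiple. The error carries the factor
  \<open>t\<close> as well, so \<open>e\<close> can be fixed before \<open>t\<close> is
  known.\<close>

lemma wnorm_contraction:
  assumes "0 < e"
  obtains t where "0 < t" "t \<le> 1"
    "\<And>g. g \<in> L2 M \<Longrightarrow> (\<integral>x. g x * w x \<partial>M) = 0 \<Longrightarrow>
       wnorm (kernel_op M K g) \<le> (1 - t) * wnorm g + t * e * L2_norm M g"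
proof -
  define E where "E = (\<lambda>n x y. max 0 (w x * v y - real n * K x y))"
  have KP: "AE z in M \<Otimes>\<^sub>M M. 0 < (case z of (x, y) \<Rightarrow> K x y)"
    using kernel_pos by (auto intro!: AE_I2)
  note E = hs_norm_excess_tendsto_zero[OF E_def L2_measurable[OF kernel_L2] KP eigen_product_L2
      AE_eigen_product_pos]
  \<comment> \<open>The threshold for the excess is \<open>e / (2 * (L2_norm M w + 1))\<close>: the
    2 absorbs the factor in \<open>2 * t * E n x y\<close>, the norm of \<open>w\<close> comes from
    pairing the error with \<open>w\<close>, and the summand 1 makes the denominator evidently
    positive.\<close>
  have Nw: "0 < 2 * (L2_norm M w + 1)"
    by (rule mult_pos_pos[OF _ add_nonneg_pos[OF L2_norm_nonneg]]) simp_all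
  with assms have pos: "0 < e / (2 * (L2_norm M w + 1))"
    by (rule divide_pos_pos)
  obtain n0 where n0: "\<And>n. n0 \<le> n \<Longrightarrow> hs_norm M (E n) < e / (2 * (L2_norm M w + 1))"
    using order_tendstoD(2)[OF E(2) pos] by (auto simp: eventually_sequentially)
  \<comment> \<open>The successor guarantees \<open>n \<ge> 1\<close>, so that
    \<open>t = 1 / n\<close> lies in the half-open interval from 0 to 1.\<close>
  define n where "n = Suc n0"
  have n: "hs_norm M (E n) < e / (2 * (L2_norm M w + 1))" and npos: "0 < real n"
    using n0[of n] by (auto simp: n_def)
  define t where "t = 1 / real n"
  interpret E: hs_kernel M "E n" by (rule E(1))
  have hs0: "0 \<le> hs_norm M (E n)" by (simp add: hs_norm_def)
  have hsw: "2 * (hs_norm M (E n) * L2_norm M w) \<le> e"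
  proof -
    have "hs_norm M (E n) * (2 * (L2_norm M w + 1)) < e"
      using n unfolding pos_less_divide_eq[OF Nw] .
    then show ?thesis using hs0 by (simp add: algebra_simps)
  qed
  show thesis
  proof
    show "0 < t" "t \<le> 1" by (auto simp: t_def n_def)
    fix g :: "'a \<Rightarrow> real" assume g: "g \<in> L2 M" and g0: "(\<integral>x. g x * w x \<partial>M) = 0"
    let ?a = "\<lambda>x. \<bar>g x\<bar>"
    let ?rhs = "\<lambda>y. kernel_op M K ?a y - t * wnorm g * v y + 2 * t * kernel_op M (E n) ?a y"
    have ga: "?a \<in> L2 M" by (rule L2_abs[OF g])
    have le: "AE y in M. \<bar>kernel_op M K g y\<bar> \<le> ?rhs y"
      using AE_kernel_integrable[OF ga] E.AE_kernel_integrable[OF ga] AE_kernel_integrable[OF g]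
    proof eventually_elim
      case (elim y)
      have i: "integrable M (\<lambda>x. ?a x * w x)" "integrable M (\<lambda>x. g x * w x)"
        by (rule L2_integrable_mult[OF _ left_L2], fact)+
      \<comment> \<open>On the complement \<open>K\<close> may be replaced by \<open>K - t w \<otimes> v\<close>, which is positive up to the excess.\<close>
      have id: "\<bar>K x y - t * (w x * v y)\<bar> = K x y - t * (w x * v y) + 2 * t * E n x y" for x
      proof -
        have "t * E n x y = max 0 (t * (w x * v y) - K x y)"
          using npos by (simp add: E_def t_def max_def field_simps)
        then have *: "2 * t * E n x y = 2 * max 0 (t * (w x * v y) - K x y)"
          by (simp only: mult.assoc)
        show ?thesis unfolding * by (simp add: max_def abs_if)
      qed
      have "kernel_op M K g y = (\<integral>x. K x y * g x - t * v y * (g x * w x) \<partial>M)"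
        using i elim g0 by (simp add: kernel_op_def)
      also have "\<bar>\<dots>\<bar> \<le> (\<integral>x. \<bar>K x y * g x - t * v y * (g x * w x)\<bar> \<partial>M)"
        by (rule integral_abs_bound)
      also have "\<dots> = (\<integral>x. K x y * ?a x - t * v y * (?a x * w x) + 2 * t * (E n x y * ?a x) \<partial>M)"
      proof (rule Bochner_Integration.integral_cong[OF refl])
        fix x
        have "\<bar>K x y * g x - t * v y * (g x * w x)\<bar> = \<bar>(K x y - t * (w x * v y)) * g x\<bar>"
          by (simp add: algebra_simps)
        also have "\<dots> = (K x y - t * (w x * v y) + 2 * t * E n x y) * ?a x"
          by (simp only: abs_mult id)
        finally show "\<bar>K x y * g x - t * v y * (g x * w x)\<bar>
            = K x y * ?a x - t * v y * (?a x * w x) + 2 * t * (E n x y * ?a x)"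
          by (simp add: algebra_simps)
      qed
      also have "\<dots> = (\<integral>x. K x y * ?a x \<partial>M) - t * v y * (\<integral>x. ?a x * w x \<partial>M) + 2 * t * (\<integral>x. E n x y * ?a x \<partial>M)"
        using i elim by simp
      also have "\<dots> = ?rhs y"
        by (simp add: kernel_op_def wnorm_def)
      finally show ?case .
    qed
    note KL = kernel_op_L2(1)[OF ga] note EL = E.kernel_op_L2[OF ga]
    note ii = L2_integrable_mult[OF KL left_L2] L2_integrable_mult[OF right_L2 left_L2]
      L2_integrable_mult[OF EL(1) left_L2]
    have "wnorm (kernel_op M K g) \<le> (\<integral>y. kernel_op M K ?a y * w y - t * wnorm g * (v y * w y)
        + 2 * t * (kernel_op M (E n) ?a y * w y) \<partial>M)"
      unfolding wnorm_def[of "kernel_op M K g"]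
    proof (rule integral_mono_AE)
      show "integrable M (\<lambda>x. \<bar>kernel_op M K g x\<bar> * w x)"
        by (rule L2_integrable_mult[OF L2_abs[OF kernel_op_L2(1)[OF g]] left_L2])
      show "AE y in M. \<bar>kernel_op M K g y\<bar> * w y \<le> kernel_op M K ?a y * w y - t * wnorm g * (v y * w y)
        + 2 * t * (kernel_op M (E n) ?a y * w y)"
        using le left_pos
      proof eventually_elim
        case (elim y)
        have "\<bar>kernel_op M K g y\<bar> * w y \<le> ?rhs y * w y"
          using elim by (intro mult_right_mono) auto
        then show ?case by (simp add: algebra_simps)
      qed
    qed (use ii in auto)
    \<comment> \<open>Invariance of the pairing with \<open>w\<close> evaluates the first term, and
      the normalisation of \<open>v\<close> and \<open>w\<close> the second; this produces the
      factor \<open>1 - t\<close>.\<close>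
    also have "\<dots> = wnorm g - t * wnorm g + 2 * t * (\<integral>y. kernel_op M (E n) ?a y * w y \<partial>M)"
      using ii inner_kernel_op[OF ga] by (simp add: normalised wnorm_def)
    also have "\<dots> \<le> wnorm g - t * wnorm g + 2 * t * (hs_norm M (E n) * L2_norm M g * L2_norm M w)"
    proof -
      have "(\<integral>y. kernel_op M (E n) ?a y * w y \<partial>M) \<le> L2_norm M (kernel_op M (E n) ?a) * L2_norm M w"
        using L2_Cauchy_Schwarz[OF EL(1) left_L2] by linarith
      also have "\<dots> \<le> hs_norm M (E n) * L2_norm M g * L2_norm M w"
        using EL(2) by (intro mult_right_mono) auto
      finally show ?thesis
        using \<open>0 < t\<close> by (intro add_left_mono mult_left_mono) auto
    qed
    also have "\<dots> \<le> (1 - t) * wnorm g + t * e * L2_norm M g"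
      using mult_right_mono[OF hsw, of "t * L2_norm M g"] \<open>0 < t\<close> by (simp add: algebra_simps)
    finally show "wnorm (kernel_op M K g) \<le> (1 - t) * wnorm g + t * e * L2_norm M g" .
  qed
qed

text \<open>The two estimates complement each other: one shrinks the \<open>L2\<close> norm at the
  price of \<open>wnorm\<close>, the other shrinks \<open>wnorm\<close> at a small price in
  \<open>L2\<close>. A weighted sum \<open>Q\<close> of the two norms is therefore strictly
  contracted, and it is equivalent to the \<open>L2\<close> norm.\<close>

lemma contraction_on_complement:
  obtains \<kappa> D where "0 \<le> \<kappa>" "\<kappa> < 1" "0 \<le> D"
    "\<And>g k. g \<in> L2 M \<Longrightarrow> (\<integral>x. g x * w x \<partial>M) = 0 \<Longrightarrow>
       L2_norm M ((kernel_op M K ^^ k) g) \<le> D * \<kappa> ^ k * L2_norm M g"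
proof -
  obtain C where C: "0 < C"
    "\<And>g. g \<in> L2 M \<Longrightarrow> L2_norm M (kernel_op M K g) \<le> C * wnorm g + 1/4 * L2_norm M g"
    using Lasota_Yorke by blast
  \<comment> \<open>This tolerance turns the \<open>L2\<close> error of
    \<open>wnorm_contraction\<close> into half of \<open>\<delta> * L2_norm M g\<close>, leaving
    room for the quarter contributed by \<open>Lasota_Yorke\<close>.\<close>
  have "0 < 1 / (4 * C)" using C by simp
  then obtain t where t: "0 < t" "t \<le> 1"
    "\<And>g. g \<in> L2 M \<Longrightarrow> (\<integral>x. g x * w x \<partial>M) = 0 \<Longrightarrow>
       wnorm (kernel_op M K g) \<le> (1 - t) * wnorm g + t * (1 / (4 * C)) * L2_norm M g"
    using wnorm_contraction by blast
  \<comment> \<open>With this \<open>\<delta>\<close> the coefficient \<open>1 - t + \<delta> C\<close> of \<open>wnorm g\<close> is \<open>1 - t / 2\<close>, and that of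
    \<open>\<delta> \<parallel>g\<parallel>\<^sub>2\<close> is \<open>3 / 4\<close>.\<close>
  define \<delta> where "\<delta> = t / (2 * C)"
  define \<kappa> where "\<kappa> = max (1 - t / 2) (3 / 4)"
  define Q where "Q g = wnorm g + \<delta> * L2_norm M g" for g
  have \<delta>: "0 < \<delta>" "\<delta> * C = t / 2" "t * (1 / (4 * C)) = \<delta> / 2"
    using C t by (auto simp: \<delta>_def)
  have \<kappa>: "0 \<le> \<kappa>" "\<kappa> < 1" "1 - t / 2 \<le> \<kappa>" "3 / 4 \<le> \<kappa>"
    using t by (auto simp: \<kappa>_def)
  have step: "Q (kernel_op M K g) \<le> \<kappa> * Q g" if g: "g \<in> L2 M" "(\<integral>x. g x * w x \<partial>M) = 0" for g
  proof -
    have "Q (kernel_op M K g) \<le> (1 - t) * wnorm g + \<delta> / 2 * L2_norm M g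
        + \<delta> * (C * wnorm g + 1/4 * L2_norm M g)"
      unfolding Q_def using t(3)[OF g, unfolded \<delta>(3)] C(2)[OF g(1)] \<delta>(1)
      by (intro add_mono mult_left_mono) simp_all
    also have "\<dots> = (1 - t + \<delta> * C) * wnorm g + 3 / 4 * (\<delta> * L2_norm M g)"
      by (simp add: algebra_simps)
    also have "\<dots> \<le> \<kappa> * wnorm g + \<kappa> * (\<delta> * L2_norm M g)"
      using \<delta> \<kappa> wnorm_nonneg by (intro add_mono mult_right_mono) auto
    finally show ?thesis by (simp add: Q_def algebra_simps)
  qed
  have iter: "(kernel_op M K ^^ k) g \<in> L2 M \<and> (\<integral>x. (kernel_op M K ^^ k) g x * w x \<partial>M) = 0
      \<and> Q ((kernel_op M K ^^ k) g) \<le> \<kappa> ^ k * Q g" if g: "g \<in> L2 M" "(\<integral>x. g x * w x \<partial>M) = 0" for g k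
  proof (induction k)
    case (Suc k)
    then have "Q (kernel_op M K ((kernel_op M K ^^ k) g)) \<le> \<kappa> * (\<kappa> ^ k * Q g)"
      using step[of "(kernel_op M K ^^ k) g"] \<kappa>(1) by (meson mult_left_mono order_trans)
    with Suc show ?case
      using inner_kernel_op[of "(kernel_op M K ^^ k) g"] by (simp add: kernel_op_L2 mult.assoc)
  qed (use g in auto)
  show thesis
  proof
    show "0 \<le> \<kappa>" "\<kappa> < 1" by fact+
    \<comment> \<open>The constant is the ratio of the two equivalence bounds: \<open>Q\<close> is
      at least \<open>\<delta>\<close> times and at most \<open>L2_norm M w + \<delta>\<close> times
      the \<open>L2\<close> norm.\<close>
    show "0 \<le> (L2_norm M w + \<delta>) / \<delta>" using \<delta> by (simp add: add_nonneg_nonneg)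
    fix g :: "'a \<Rightarrow> real" and k
    assume g: "g \<in> L2 M" "(\<integral>x. g x * w x \<partial>M) = 0"
    have "\<delta> * L2_norm M ((kernel_op M K ^^ k) g) \<le> \<kappa> ^ k * Q g"
      using iter[OF g, of k] wnorm_nonneg[of "(kernel_op M K ^^ k) g"] by (simp add: Q_def)
    also have "\<dots> \<le> \<kappa> ^ k * ((L2_norm M w + \<delta>) * L2_norm M g)"
      using \<kappa> wnorm_le[OF g(1)] by (intro mult_left_mono) (auto simp: Q_def algebra_simps)
    finally show "L2_norm M ((kernel_op M K ^^ k) g) \<le> (L2_norm M w + \<delta>) / \<delta> * \<kappa> ^ k * L2_norm M g"
      using \<delta>(1) by (simp add: field_simps)
  qed
qed

text \<open>Linearity and the eigenvalue equation hold only almost everywhere, so each iteration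
  adds an exceptional null set; \<open>kernel_op_cong_AE\<close> carries the identity through the
  next application.\<close>

lemma funpow_minus_eigen:
  assumes g: "g \<in> L2 M"
  shows "AE x in M. (kernel_op M K ^^ k) (\<lambda>x. g x - \<alpha> * v x) x = (kernel_op M K ^^ k) g x - \<alpha> * v x"
proof (induction k)
  case (Suc k)
  let ?h = "(kernel_op M K ^^ k) (\<lambda>x. g x - \<alpha> * v x)"
  have L: "?h \<in> L2 M" "(kernel_op M K ^^ k) g \<in> L2 M" "(\<lambda>x. \<alpha> * v x) \<in> L2 M"
    by (intro kernel_op_funpow_L2 L2_diff L2_cmult g right_L2)+
  have "AE y in M. kernel_op M K ?h y = kernel_op M K (\<lambda>x. (kernel_op M K ^^ k) g x - \<alpha> * v x) y"
    using L L2_diff[OF L(2,3)] Suc by (intro kernel_op_cong_AE) (auto simp: L2_def)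
  with kernel_op_diff[OF L(2,3)] right_eigen show ?case
    by eventually_elim (simp add: kernel_op_cmult)
qed simp

text \<open>Split off the component along \<open>v\<close>: by the normalisation the remainder lies
  in the complement, where the powers decay geometrically.\<close>

theorem spectral_gap:
  obtains \<kappa> D where "0 \<le> \<kappa>" "\<kappa> < 1" "0 \<le> D"
    "\<And>g k. g \<in> L2 M \<Longrightarrow>
       L2_norm M (\<lambda>x. (kernel_op M K ^^ k) g x - (\<integral>x. g x * w x \<partial>M) * v x) \<le> D * \<kappa> ^ k * L2_norm M g"
proof -
  obtain \<kappa> D where D: "0 \<le> \<kappa>" "\<kappa> < 1" "0 \<le> D"
    "\<And>g k. g \<in> L2 M \<Longrightarrow> (\<integral>x. g x * w x \<partial>M) = 0 \<Longrightarrow>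
       L2_norm M ((kernel_op M K ^^ k) g) \<le> D * \<kappa> ^ k * L2_norm M g"
    using contraction_on_complement by blast
  \<comment> \<open>A bound for the norm of the projection that removes the component along
    \<open>v\<close>.\<close>
  define c where "c = 1 + L2_norm M w * L2_norm M v"
  have c: "0 \<le> c" by (simp add: c_def)
  show thesis
  proof
    show "0 \<le> \<kappa>" "\<kappa> < 1" "0 \<le> D * c" using D c by auto
    fix g :: "'a \<Rightarrow> real" and k assume g: "g \<in> L2 M"
    define \<alpha> where "\<alpha> = (\<integral>x. g x * w x \<partial>M)"
    let ?h = "\<lambda>x. g x - \<alpha> * v x"
    have h: "?h \<in> L2 M" by (intro L2_diff L2_cmult g right_L2)
    have h0: "(\<integral>x. ?h x * w x \<partial>M) = 0"
      using L2_integrable_mult[OF g left_L2] L2_integrable_mult[OF right_L2 left_L2] normalised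
      by (simp add: left_diff_distrib mult.assoc \<alpha>_def)
    have "L2_norm M (\<lambda>x. (kernel_op M K ^^ k) g x - \<alpha> * v x) = L2_norm M ((kernel_op M K ^^ k) ?h)"
    proof (rule L2_norm_cong_AE)
      show "AE x in M. (kernel_op M K ^^ k) g x - \<alpha> * v x = (kernel_op M K ^^ k) ?h x"
        using funpow_minus_eigen[OF g, of k \<alpha>] by eventually_elim simp
    qed (intro L2_diff L2_cmult kernel_op_funpow_L2 h g right_L2)+
    also have "\<dots> \<le> D * \<kappa> ^ k * L2_norm M ?h"
      by (rule D(4)[OF h h0])
    also have "\<dots> \<le> D * \<kappa> ^ k * (c * L2_norm M g)"
    proof (rule mult_left_mono)
      have "L2_norm M ?h \<le> L2_norm M g + \<bar>\<alpha>\<bar> * L2_norm M v"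
        using L2_norm_triangle_diff[OF g L2_cmult[OF right_L2]] by (simp add: L2_norm_cmult)
      also have "\<dots> \<le> L2_norm M g + (L2_norm M g * L2_norm M w) * L2_norm M v"
        unfolding \<alpha>_def by (intro add_left_mono mult_right_mono L2_Cauchy_Schwarz g left_L2) simp
      finally show "L2_norm M ?h \<le> c * L2_norm M g" by (simp add: c_def algebra_simps)
    qed (use D in simp)
    finally show "L2_norm M (\<lambda>x. (kernel_op M K ^^ k) g x - (\<integral>x. g x * w x \<partial>M) * v x)
        \<le> D * c * \<kappa> ^ k * L2_norm M g"
      by (simp add: \<alpha>_def mult_ac)
  qed
qed

text \<open>Every power is a fixed rank-one operator plus a bounded error. The length of the window
  will occur as the exponent, so this bound supplies the uniformity in \<open>n\<close>.\<close>

lemma power_bounded: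
  obtains B where "0 \<le> B"
    "\<And>(g :: 'a \<Rightarrow> real) k. g \<in> L2 M \<Longrightarrow> L2_norm M ((kernel_op M K ^^ k) g) \<le> B * L2_norm M g"
proof -
  obtain \<kappa> D where D: "0 \<le> \<kappa>" "\<kappa> < 1" "0 \<le> D"
    "\<And>g k. g \<in> L2 M \<Longrightarrow>
       L2_norm M (\<lambda>x. (kernel_op M K ^^ k) g x - (\<integral>x. g x * w x \<partial>M) * v x) \<le> D * \<kappa> ^ k * L2_norm M g"
    using spectral_gap by blast
  show thesis
  proof
    show "0 \<le> D + L2_norm M w * L2_norm M v" using D by simp
    fix g :: "'a \<Rightarrow> real" and k assume g: "g \<in> L2 M"
    define \<alpha> where "\<alpha> = (\<integral>x. g x * w x \<partial>M)"
    have "D * \<kappa> ^ k * L2_norm M g \<le> D * 1 * L2_norm M g"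
      using D by (intro mult_right_mono mult_left_mono power_le_one) auto
    moreover have "L2_norm M ((kernel_op M K ^^ k) g)
        \<le> L2_norm M (\<lambda>x. (kernel_op M K ^^ k) g x - \<alpha> * v x) + \<bar>\<alpha>\<bar> * L2_norm M v"
      using L2_norm_triangle[OF L2_diff[OF kernel_op_funpow_L2[OF g] L2_cmult[OF right_L2]] L2_cmult[OF right_L2], of k \<alpha> \<alpha>]
      by (simp add: L2_norm_cmult)
    moreover have "\<bar>\<alpha>\<bar> * L2_norm M v \<le> (L2_norm M g * L2_norm M w) * L2_norm M v"
      unfolding \<alpha>_def
      by (rule mult_right_mono[OF L2_Cauchy_Schwarz[OF g left_L2] L2_norm_nonneg])
    moreover note D(4)[OF g, of k, folded \<alpha>_def]
    ultimately show "L2_norm M ((kernel_op M K ^^ k) g) \<le> (D + L2_norm M w * L2_norm M v) * L2_norm M g"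
      by (simp add: algebra_simps)
  qed
qed

end

section \<open>Integrating out the coordinates of a path\<close>

lemma (in product_sigma_finite) AE_PiM_component:
  assumes "finite I" "i \<in> I" "AE y in M i. P y"
  shows "AE x in PiM I M. P (x i)"
proof -
  obtain N where N: "{y \<in> space (M i). \<not> P y} \<subseteq> N" "N \<in> sets (M i)" "emeasure (M i) N = 0"
    using assms(3) by (auto elim: AE_E)
  let ?A = "\<lambda>j. if j = i then N else space (M j)"
  show ?thesis
  proof (rule AE_I)
    show "{x \<in> space (PiM I M). \<not> P (x i)} \<subseteq> Pi\<^sub>E I ?A"
      using N(1) assms(2) by (auto simp: space_PiM PiE_iff extensional_def)
    show "Pi\<^sub>E I ?A \<in> sets (PiM I M)"
      using assms(1) N(2) by (intro sets_PiM_I_finite) auto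
    have "emeasure (PiM I M) (Pi\<^sub>E I ?A) = (\<Prod>j\<in>I. emeasure (M j) (?A j))"
      using assms(1) N(2) by (intro emeasure_PiM) auto
    \<comment> \<open>One factor is 0; in \<open>ennreal\<close> a product with 0 is 0 even when the
      other coordinate spaces have infinite measure.\<close>
    also have "\<dots> = 0"
      using assms(1,2) N(3) by (auto simp: prod_zero_iff)
    finally show "emeasure (PiM I M) (Pi\<^sub>E I ?A) = 0" .
  qed
qed

text \<open>Extended nonnegative twin of \<open>kernel_op\<close>, as \<open>nn_path\<close> is of
  \<open>path_weight\<close>: Tonelli lets coordinates be integrated out before finiteness is
  known.\<close>

definition nn_op :: "'a measure \<Rightarrow> ('a \<Rightarrow> 'a \<Rightarrow> ennreal) \<Rightarrow> ('a \<Rightarrow> ennreal) \<Rightarrow> 'a \<Rightarrow> ennreal" where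
  "nn_op M K g y = (\<integral>\<^sup>+x. K x y * g x \<partial>M)"

definition nn_path ::
  "('a \<Rightarrow> 'a \<Rightarrow> ennreal) \<Rightarrow> ('a \<Rightarrow> ennreal) \<Rightarrow> ('a \<Rightarrow> ennreal) \<Rightarrow> int \<Rightarrow> int \<Rightarrow> (int \<Rightarrow> 'a) \<Rightarrow> ennreal" where
  "nn_path K u w a b x = u (x a) * (\<Prod>i\<in>{a+1..b}. K (x (i - 1)) (x i)) * w (x b)"

section \<open>Path integrals by Tonelli, one endpoint at a time\<close>

lemma nn_path_cong:
  assumes "a \<le> b" "\<And>i. a \<le> i \<Longrightarrow> i \<le> b \<Longrightarrow> x i = y i"
  shows "nn_path K u w a b x = nn_path K u w a b y"
  using assms unfolding nn_path_def by (intro arg_cong2[where f = "(*)"] prod.cong) auto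

lemma nn_path_left:
  assumes "a < b"
  shows "nn_path K u w a b (x(a := y)) =
    K y (x (a + 1)) * u y * ((\<Prod>i\<in>{a+2..b}. K (x (i - 1)) (x i)) * w (x b))"
proof -
  have "{a+1..b} = insert (a+1) {a+2..b}" using assms by auto
  moreover have "(\<Prod>i\<in>{a+2..b}. K ((x(a := y)) (i - 1)) ((x(a := y)) i)) = (\<Prod>i\<in>{a+2..b}. K (x (i - 1)) (x i))"
    by (rule prod.cong) auto
  ultimately show ?thesis using assms by (simp add: nn_path_def mult_ac)
qed

lemma nn_path_right:
  assumes "a < b"
  shows "nn_path K u w a b (x(b := y)) =
    K (x (b - 1)) y * w y * (u (x a) * (\<Prod>i\<in>{a+1..b-1}. K (x (i - 1)) (x i)))"
proof -
  have "{a+1..b} = insert b {a+1..b-1}" using assms by auto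
  moreover have "(\<Prod>i\<in>{a+1..b-1}. K ((x(b := y)) (i - 1)) ((x(b := y)) i)) = (\<Prod>i\<in>{a+1..b-1}. K (x (i - 1)) (x i))"
    by (rule prod.cong) auto
  ultimately show ?thesis using assms by (simp add: nn_path_def mult_ac)
qed

text \<open>The coordinate being integrated out thus reaches the merged path as a point update, the
  form in which \<open>nn_path_integral_left\<close> and \<open>nn_path_integral_right\<close>
  apply.\<close>

lemma merge_insert_right:
  assumes "a \<notin> I"
  shows "merge I (insert a J) (x, z(a := y)) = (merge I J (x, z))(a := y)"
  using assms by (auto simp: merge_def fun_eq_iff)

locale nn_kernel = sigma_finite_measure M for M :: "'a measure" +
  fixes K :: "'a \<Rightarrow> 'a \<Rightarrow> ennreal"
  assumes nn_kernel_measurable [measurable]: "(\<lambda>(x, y). K x y) \<in> borel_measurable (M \<Otimes>\<^sub>M M)"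
begin

sublocale pair: pair_sigma_finite M M ..

sublocale product: product_sigma_finite "\<lambda>_ :: int. M" ..

lemma nn_kernel_transpose: "nn_kernel M (\<lambda>x y. K y x)"
  by unfold_locales measurable

lemma nn_op_measurable [measurable]:
  assumes [measurable]: "g \<in> borel_measurable M"
  shows "nn_op M K g \<in> borel_measurable M"
  unfolding nn_op_def by measurable

lemma nn_op_funpow_measurable:
  assumes "g \<in> borel_measurable M"
  shows "(nn_op M K ^^ k) g \<in> borel_measurable M"
  by (induction k) (auto intro: assms nn_op_measurable)

lemma nn_path_measurable:
  assumes [measurable]: "u \<in> borel_measurable M" "w \<in> borel_measurable M"
    and "a \<le> b" "{a..b} \<subseteq> I"
  shows "nn_path K u w a b \<in> borel_measurable (PiM I (\<lambda>_. M))"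
proof -
  have [measurable]: "(\<lambda>x. x i) \<in> measurable (PiM I (\<lambda>_. M)) M" if "i \<in> {a..b}" for i
    using that assms(4) by (intro measurable_component_singleton) auto
  have "(\<lambda>x. K (x (i - 1)) (x i)) \<in> borel_measurable (PiM I (\<lambda>_. M))" if "i \<in> {a+1..b}" for i
  proof -
    have [measurable]: "(\<lambda>x. x i) \<in> measurable (PiM I (\<lambda>_. M)) M" "(\<lambda>x. x (i - 1)) \<in> measurable (PiM I (\<lambda>_. M)) M"
      using that assms(4) by (auto intro!: measurable_component_singleton)
    show ?thesis by measurable
  qed
  moreover have "(\<lambda>x. x a) \<in> measurable (PiM I (\<lambda>_. M)) M" "(\<lambda>x. x b) \<in> measurable (PiM I (\<lambda>_. M)) M"
    using assms(3,4) by (auto intro!: measurable_component_singleton)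
  then have "(\<lambda>x. u (x a)) \<in> borel_measurable (PiM I (\<lambda>_. M))" "(\<lambda>x. w (x b)) \<in> borel_measurable (PiM I (\<lambda>_. M))"
    by measurable
  ultimately show ?thesis
    unfolding nn_path_def by (intro borel_measurable_times_ennreal borel_measurable_prod_ennreal) auto
qed

text \<open>Only the boundary function and the first edge involve the endpoint, so integrating it
  out absorbs that edge into the boundary function. At the right end the same happens with the
  transposed kernel.\<close>

lemma nn_path_integral_left:
  assumes [measurable]: "u \<in> borel_measurable M" and "a < b" and x: "x (a + 1) \<in> space M"
  shows "(\<integral>\<^sup>+y. nn_path K u w a b (x(a := y)) \<partial>M) = nn_path K (nn_op M K u) w (a + 1) b x"
proof -
  have "(\<lambda>y. K y (x (a + 1)) * u y) \<in> borel_measurable M"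
    using x by measurable
  then show ?thesis
    unfolding nn_path_left[OF \<open>a < b\<close>]
    by (subst nn_integral_multc) (simp_all add: nn_op_def nn_path_def mult.assoc add.commute)
qed

lemma nn_path_integral_right:
  assumes [measurable]: "w \<in> borel_measurable M" and "a < b" and x: "x (b - 1) \<in> space M"
  shows "(\<integral>\<^sup>+y. nn_path K u w a b (x(b := y)) \<partial>M) = nn_path K u (nn_op M (\<lambda>x y. K y x) w) a (b - 1) x"
proof -
  have [measurable]: "(\<lambda>y. K (x (b - 1)) y) \<in> borel_measurable M"
    using x by measurable
  show ?thesis
    unfolding nn_path_right[OF \<open>a < b\<close>]
    by (subst nn_integral_multc) (simp_all add: nn_op_def nn_path_def mult_ac)
qed

lemma nn_path_total:
  assumes "u \<in> borel_measurable M" and w: "w \<in> borel_measurable M"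
  shows "(\<integral>\<^sup>+x. nn_path K u w a (a + int N) x \<partial>PiM {a..a + int N} (\<lambda>_. M))
    = (\<integral>\<^sup>+y. (nn_op M K ^^ N) u y * w y \<partial>M)"
  using assms(1)
proof (induction N arbitrary: a u)
  case 0
  then show ?case
    using w product.product_nn_integral_singleton[of "\<lambda>y. u y * w y" a]
    by (simp add: nn_path_def)
next
  case (Suc N)
  have eq: "a + int (Suc N) = a + 1 + int N" "{a..a + 1 + int N} = insert a {a+1..a + 1 + int N}" by auto
  have "(\<integral>\<^sup>+x. nn_path K u w a (a + int (Suc N)) x \<partial>PiM {a..a + int (Suc N)} (\<lambda>_. M))
     = (\<integral>\<^sup>+x. \<integral>\<^sup>+y. nn_path K u w a (a + 1 + int N) (x(a := y)) \<partial>M \<partial>PiM {a+1..a + 1 + int N} (\<lambda>_. M))"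
    unfolding eq(1) unfolding eq(2)
    by (rule product.product_nn_integral_insert) (auto intro!: nn_path_measurable Suc.prems w)
  also have "\<dots> = (\<integral>\<^sup>+x. nn_path K (nn_op M K u) w (a + 1) (a + 1 + int N) x \<partial>PiM {a+1..a + 1 + int N} (\<lambda>_. M))"
    by (intro nn_integral_cong nn_path_integral_left Suc.prems) (auto simp: space_PiM PiE_iff)
  also have "\<dots> = (\<integral>\<^sup>+y. (nn_op M K ^^ N) (nn_op M K u) y * w y \<partial>M)"
    by (intro Suc.IH nn_op_measurable Suc.prems)
  finally show ?case by (simp add: funpow_swap1)
qed

lemma nn_path_merge_measurable:
  assumes "u \<in> borel_measurable M" "w \<in> borel_measurable M"
    and "a \<le> b" "{a..b} \<subseteq> I \<union> J" and "x \<in> space (PiM I (\<lambda>_. M))"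
  shows "(\<lambda>z. nn_path K u w a b (merge I J (x, z))) \<in> borel_measurable (PiM J (\<lambda>_. M))"
  using measurable_compose[OF measurable_Pair1'[OF assms(5)] measurable_compose[OF measurable_merge nn_path_measurable[OF assms(1-4)]]]
  by simp

text \<open>The outermost left coordinate is removed at each step, which replaces \<open>u\<close>
  by its image; hence the induction over arbitrary \<open>u\<close>. The set \<open>J\<close>
  carries the coordinates to the right of the window along unchanged.\<close>

lemma nn_path_extend_left:
  assumes "u \<in> borel_measurable M" and w: "w \<in> borel_measurable M"
    and N: "0 \<le> N" "N \<le> b" "0 < b" and J: "finite J" "{N+1..b} \<subseteq> J" "J \<inter> {..N} = {}"
    and x: "x \<in> space (PiM {0..N} (\<lambda>_. M))"
  shows "(\<integral>\<^sup>+z. nn_path K u w (- int l) b (merge {0..N} ({- int l..-1} \<union> J) (x, z)) \<partial>PiM ({- int l..-1} \<union> J) (\<lambda>_. M))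
    = (\<integral>\<^sup>+z. nn_path K ((nn_op M K ^^ l) u) w 0 b (merge {0..N} J (x, z)) \<partial>PiM J (\<lambda>_. M))"
  using assms(1)
proof (induction l arbitrary: u)
  case (Suc l)
  let ?a = "- int (Suc l)" and ?J = "{- int l..-1} \<union> J"
  have eq: "{?a..-1} \<union> J = insert ?a ?J" by auto
  have a: "?a \<notin> ?J" "?a \<notin> {0..N}" "?a < b" "?a + 1 = - int l" using J(3) N by auto
  have "(\<integral>\<^sup>+z. nn_path K u w ?a b (merge {0..N} (insert ?a ?J) (x, z)) \<partial>PiM (insert ?a ?J) (\<lambda>_. M))
     = (\<integral>\<^sup>+z. \<integral>\<^sup>+y. nn_path K u w ?a b (merge {0..N} (insert ?a ?J) (x, z(?a := y))) \<partial>M \<partial>PiM ?J (\<lambda>_. M))"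
  proof (rule product.product_nn_integral_insert)
    show "(\<lambda>z. nn_path K u w ?a b (merge {0..N} (insert ?a ?J) (x, z))) \<in> borel_measurable (PiM (insert ?a ?J) (\<lambda>_. M))"
      using N J(2) by (intro nn_path_merge_measurable Suc.prems w x) (auto simp: subset_iff not_le)
  qed (use J(1) a in auto)
  also have "\<dots> = (\<integral>\<^sup>+z. nn_path K (nn_op M K u) w (- int l) b (merge {0..N} ?J (x, z)) \<partial>PiM ?J (\<lambda>_. M))"
    unfolding merge_insert_right[OF a(2)] a(4)[symmetric]
  proof (intro nn_integral_cong nn_path_integral_left Suc.prems a(3))
    fix z assume "z \<in> space (PiM ({?a + 1..-1} \<union> J) (\<lambda>_. M))"
    then show "merge {0..N} ({?a + 1..-1} \<union> J) (x, z) (?a + 1) \<in> space M"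
      using x N(1) by (auto simp: merge_def space_PiM PiE_iff)
  qed
  also have "\<dots> = (\<integral>\<^sup>+z. nn_path K ((nn_op M K ^^ l) (nn_op M K u)) w 0 b (merge {0..N} J (x, z)) \<partial>PiM J (\<lambda>_. M))"
    by (intro Suc.IH nn_op_measurable Suc.prems)
  finally show ?case unfolding eq by (simp add: funpow_swap1)
qed simp

lemma nn_path_extend_right:
  assumes u: "u \<in> borel_measurable M" and "w \<in> borel_measurable M"
    and N: "0 \<le> N" and x: "x \<in> space (PiM {0..N} (\<lambda>_. M))"
  shows "(\<integral>\<^sup>+z. nn_path K u w 0 (N + int k) (merge {0..N} {N+1..N + int k} (x, z)) \<partial>PiM {N+1..N + int k} (\<lambda>_. M))
    = nn_path K u ((nn_op M (\<lambda>x y. K y x) ^^ k) w) 0 N x"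
  using assms(2)
proof (induction k arbitrary: w)
  case 0
  \<comment> \<open>No outer coordinate is left: the integrand is constant, and the product over the
    empty index set has total mass 1.\<close>
  have "nn_path K u w 0 N (merge {0..N} {} (x, z)) = nn_path K u w 0 N x" for z
    using N by (intro nn_path_cong) (auto simp: merge_def)
  then show ?case by (simp add: space_PiM)
next
  case (Suc k)
  interpret T: nn_kernel M "\<lambda>x y. K y x" by (rule nn_kernel_transpose)
  let ?b = "N + int (Suc k)" and ?J = "{N+1..N + int k}"
  have eq: "{N+1..?b} = insert ?b ?J" by auto
  have b: "?b \<notin> ?J" "?b \<notin> {0..N}" "0 < ?b" "?b - 1 = N + int k" using N by auto
  have "(\<integral>\<^sup>+z. nn_path K u w 0 ?b (merge {0..N} (insert ?b ?J) (x, z)) \<partial>PiM (insert ?b ?J) (\<lambda>_. M))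
     = (\<integral>\<^sup>+z. \<integral>\<^sup>+y. nn_path K u w 0 ?b (merge {0..N} (insert ?b ?J) (x, z(?b := y))) \<partial>M \<partial>PiM ?J (\<lambda>_. M))"
  proof (rule product.product_nn_integral_insert)
    show "(\<lambda>z. nn_path K u w 0 ?b (merge {0..N} (insert ?b ?J) (x, z))) \<in> borel_measurable (PiM (insert ?b ?J) (\<lambda>_. M))"
      using N by (intro nn_path_merge_measurable u Suc.prems x) auto
  qed (use b in auto)
  also have "\<dots> = (\<integral>\<^sup>+z. nn_path K u (nn_op M (\<lambda>x y. K y x) w) 0 (N + int k) (merge {0..N} ?J (x, z)) \<partial>PiM ?J (\<lambda>_. M))"
    unfolding merge_insert_right[OF b(2)] b(4)[symmetric]
  proof (intro nn_integral_cong nn_path_integral_right Suc.prems b(3))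
    fix z assume "z \<in> space (PiM {N+1..?b - 1} (\<lambda>_. M))"
    then show "merge {0..N} {N+1..?b - 1} (x, z) (?b - 1) \<in> space M"
      using x N by (auto simp: merge_def space_PiM PiE_iff)
  qed
  also have "\<dots> = nn_path K u ((nn_op M (\<lambda>x y. K y x) ^^ k) (nn_op M (\<lambda>x y. K y x) w)) 0 N x"
    by (intro Suc.IH T.nn_op_measurable Suc.prems)
  finally show ?case unfolding eq by (simp add: funpow_swap1)
qed

lemma nn_path_extend:
  assumes "u \<in> borel_measurable M" "w \<in> borel_measurable M"
    and "0 < N" "x \<in> space (PiM {0..N} (\<lambda>_. M))"
  shows "(\<integral>\<^sup>+z. nn_path K u w (- int k) (N + int k) (merge {0..N} ({- int k..-1} \<union> {N+1..N + int k}) (x, z))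
       \<partial>PiM ({- int k..-1} \<union> {N+1..N + int k}) (\<lambda>_. M))
    = nn_path K ((nn_op M K ^^ k) u) ((nn_op M (\<lambda>x y. K y x) ^^ k) w) 0 N x"
  using assms
  by (subst nn_path_extend_left) (auto intro!: nn_path_extend_right nn_op_funpow_measurable)

end

section \<open>Total variation distance of the window densities\<close>

text \<open>On each set the two measures differ by the integral of \<open>h - q\<close> over it. The
  factor 1/2 available for probability densities is given away.\<close>

lemma tv_dist_density_le:
  fixes h q :: "'a \<Rightarrow> real"
  assumes "integrable N h" "integrable N q" "AE x in N. 0 \<le> h x" "AE x in N. 0 \<le> q x"
  shows "tv_dist (density N (\<lambda>x. ennreal (h x))) (density N (\<lambda>x. ennreal (q x))) \<le> (\<integral>x. \<bar>h x - q x\<bar> \<partial>N)"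
proof -
  have meas: "measure (density N (\<lambda>x. ennreal (g x))) A = (\<integral>x. g x * indicator A x \<partial>N)"
    if g: "integrable N g" "AE x in N. 0 \<le> g x" and A: "A \<in> sets N" for g :: "'a \<Rightarrow> real" and A
  proof -
    have "emeasure (density N (\<lambda>x. ennreal (g x))) A = (\<integral>\<^sup>+x. ennreal (g x * indicator A x) \<partial>N)"
      using g A by (subst emeasure_density) (auto intro!: nn_integral_cong split: split_indicator)
    also have "\<dots> = ennreal (\<integral>x. g x * indicator A x \<partial>N)"
      by (rule nn_integral_eq_integral)
         (use g A in \<open>auto intro: integrable_real_mult_indicator elim!: eventually_mono\<close>)
    moreover have "0 \<le> (\<integral>x. g x * indicator A x \<partial>N)"
      by (rule integral_nonneg_AE) (use g(2) in \<open>auto elim!: eventually_mono\<close>)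
    ultimately show ?thesis by (simp add: measure_def)
  qed
  show ?thesis
    unfolding tv_dist_def
  proof (rule cSUP_least)
    fix A assume "A \<in> sets (density N (\<lambda>x. ennreal (h x)))"
    then have A: "A \<in> sets N" by simp
    have i: "integrable N (\<lambda>x. h x * indicator A x)" "integrable N (\<lambda>x. q x * indicator A x)"
      using assms A by (auto intro: integrable_real_mult_indicator)
    have "measure (density N (\<lambda>x. ennreal (h x))) A - measure (density N (\<lambda>x. ennreal (q x))) A
        = (\<integral>x. h x * indicator A x - q x * indicator A x \<partial>N)"
      using i by (simp add: meas assms A)
    also have "\<bar>\<dots>\<bar> \<le> (\<integral>x. \<bar>h x * indicator A x - q x * indicator A x\<bar> \<partial>N)"
      by (rule integral_abs_bound)
    also have "\<dots> \<le> (\<integral>x. \<bar>h x - q x\<bar> \<partial>N)"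
      using i assms(1,2) by (intro integral_mono) (auto split: split_indicator)
    finally show "\<bar>measure (density N (\<lambda>x. ennreal (h x))) A - measure (density N (\<lambda>x. ennreal (q x))) A\<bar>
        \<le> (\<integral>x. \<bar>h x - q x\<bar> \<partial>N)" .
  qed auto
qed

section \<open>Rescaling the kernel\<close>

lemma path_weight_scale:
  "path_weight (\<lambda>x y. c * K x y) u w a b x = c ^ nat (b - a) * path_weight K u w a b x"
proof -
  have "card {a+1..b} = nat (b - a)" by simp
  then show ?thesis by (simp add: path_weight_def prod.distrib)
qed

text \<open>The path weight and its integral acquire the same power of \<open>c\<close>, which
  cancels in the quotient.\<close>

lemma chain_density_scale:
  assumes "c \<noteq> 0"
  shows "chain_density M (\<lambda>x y. c * K x y) f n m = chain_density M K f n m"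
  using assms unfolding chain_density_def chain_const_def path_weight_scale by auto

lemma chain_marginal_scale:
  assumes "c \<noteq> 0"
  shows "chain_marginal M (\<lambda>x y. c * K x y) f n m = chain_marginal M K f n m"
  unfolding chain_marginal_def chain_density_scale[OF assms] ..

lemma (in product_sigma_finite) AE_merge_component:
  assumes "finite I" "finite J" "i \<in> I \<union> J" "\<And>i. AE y in M i. P y"
  shows "AE x in PiM I M. AE z in PiM J M. P (merge I J (x, z) i)"
proof (cases "i \<in> I")
  case True
  show ?thesis
    using AE_PiM_component[OF assms(1) True assms(4)]
    by eventually_elim (simp add: merge_def True)
next
  case False
  then have "AE z in PiM J M. P (z i)"
    using assms by (intro AE_PiM_component) auto
  then have "AE z in PiM J M. P (merge I J (x, z) i)" for x
    by eventually_elim (use False assms(3) in \<open>auto simp: merge_def\<close>)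
  then show ?thesis by simp
qed

context perron_kernel
begin

section \<open>From extended nonnegative back to real path integrals\<close>

lemma nn_kernel_ennreal: "nn_kernel M (\<lambda>x y. ennreal (K x y))"
  by unfold_locales measurable

sublocale nn: nn_kernel M "\<lambda>x y. ennreal (K x y)"
  by (rule nn_kernel_ennreal)

lemma path_weight_measurable:
  assumes [measurable]: "u \<in> borel_measurable M" "w' \<in> borel_measurable M"
    and "a \<le> b" "{a..b} \<subseteq> I"
  shows "path_weight K u w' a b \<in> borel_measurable (PiM I (\<lambda>_. M))"
proof -
  have "(\<lambda>x. K (x (i - 1)) (x i)) \<in> borel_measurable (PiM I (\<lambda>_. M))" if "i \<in> {a+1..b}" for i
  proof -
    have [measurable]: "(\<lambda>x. x i) \<in> measurable (PiM I (\<lambda>_. M)) M" "(\<lambda>x. x (i - 1)) \<in> measurable (PiM I (\<lambda>_. M)) M"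
      using that assms(4) by (auto intro!: measurable_component_singleton)
    show ?thesis by measurable
  qed
  moreover have "(\<lambda>x. x a) \<in> measurable (PiM I (\<lambda>_. M)) M" "(\<lambda>x. x b) \<in> measurable (PiM I (\<lambda>_. M)) M"
    using assms(3,4) by (auto intro!: measurable_component_singleton)
  then have "(\<lambda>x. u (x a)) \<in> borel_measurable (PiM I (\<lambda>_. M))" "(\<lambda>x. w' (x b)) \<in> borel_measurable (PiM I (\<lambda>_. M))"
    by measurable
  ultimately show ?thesis
    unfolding path_weight_def by (intro borel_measurable_times borel_measurable_prod) auto
qed

lemma path_weight_nonneg:
  assumes "0 \<le> u (x a)" "0 \<le> w' (x b)"
  shows "0 \<le> path_weight K u w' a b x"
  unfolding path_weight_def using assms by (intro mult_nonneg_nonneg prod_nonneg) (auto simp: kernel_nonneg)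

lemma ennreal_path_weight:
  assumes "0 \<le> u (x a)" "0 \<le> w' (x b)"
    and "u' (x a) = ennreal (u (x a))" "w'' (x b) = ennreal (w' (x b))"
  shows "ennreal (path_weight K u w' a b x) = nn_path (\<lambda>x y. ennreal (K x y)) u' w'' a b x"
proof -
  have "0 \<le> (\<Prod>i\<in>{a+1..b}. K (x (i - 1)) (x i))"
    by (intro prod_nonneg) (auto simp: kernel_nonneg)
  then show ?thesis
    using assms by (simp add: path_weight_def nn_path_def ennreal_mult prod_ennreal kernel_nonneg)
qed

lemma AE_funpow_nonneg:
  fixes f :: "'a \<Rightarrow> real"
  assumes "f \<in> L2 M" "AE x in M. 0 \<le> f x"
  shows "AE x in M. 0 \<le> (kernel_op M K ^^ k) f x"
proof (induction k)
  case (Suc k)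
  then show ?case by (simp add: kernel_op_nonneg kernel_nonneg)
qed (use assms in simp)

text \<open>Where a slice is integrable the two kinds of integral agree. At an exceptional
  \<open>y\<close> the left side may be infinite while the Bochner integral defaults to 0.\<close>

lemma AE_nn_op_funpow:
  fixes f :: "'a \<Rightarrow> real"
  assumes f: "f \<in> L2 M" and f0: "AE x in M. 0 \<le> f x"
  shows "AE y in M. (nn_op M (\<lambda>x y. ennreal (K x y)) ^^ k) (\<lambda>x. ennreal (f x)) y = ennreal ((kernel_op M K ^^ k) f y)"
proof (induction k)
  case (Suc k)
  let ?g = "(kernel_op M K ^^ k) f"
  note g0 = AE_funpow_nonneg[OF f f0, of k]
  from AE_kernel_integrable[OF kernel_op_funpow_L2[OF f, of k]] show ?case
  proof eventually_elim
    case (elim y)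
    have "(\<integral>\<^sup>+x. ennreal (K x y) * (nn_op M (\<lambda>x y. ennreal (K x y)) ^^ k) (\<lambda>x. ennreal (f x)) x \<partial>M)
        = (\<integral>\<^sup>+x. ennreal (K x y * ?g x) \<partial>M)"
      by (rule nn_integral_cong_AE)
         (use Suc g0 in \<open>eventually_elim, simp add: ennreal_mult kernel_nonneg\<close>)
    also have "\<dots> = ennreal (\<integral>x. K x y * ?g x \<partial>M)"
      by (rule nn_integral_eq_integral[OF elim])
         (use g0 in \<open>eventually_elim, simp add: kernel_nonneg\<close>)
    finally show ?case by (simp add: nn_op_def[of _ _ "(_ ^^ _) _"] kernel_op_def[of _ _ "(_ ^^ _) _"])
  qed
qed simp

text \<open>Integrating out all coordinates turns a path into a matrix element of the
  \<open>N\<close>-th power, so bounds on powers become bounds on path integrals.\<close>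

lemma path_weight_integral:
  assumes u: "u \<in> L2 M" "AE x in M. 0 \<le> u x" and u': "u' \<in> L2 M" "AE x in M. 0 \<le> u' x"
  shows "integrable (PiM {0..int N} (\<lambda>_. M)) (path_weight K u u' 0 (int N))"
    and "(\<integral>x. path_weight K u u' 0 (int N) x \<partial>PiM {0..int N} (\<lambda>_. M)) = (\<integral>y. (kernel_op M K ^^ N) u y * u' y \<partial>M)"
    and "AE x in PiM {0..int N} (\<lambda>_. M). 0 \<le> path_weight K u u' 0 (int N) x"
proof -
  let ?P = "PiM {0..int N} (\<lambda>_. M)" and ?h = "path_weight K u u' 0 (int N)"
  have [measurable]: "u \<in> borel_measurable M" "u' \<in> borel_measurable M"
    using u u' by (auto simp: L2_def)
  have meas: "?h \<in> borel_measurable ?P"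
    by (rule path_weight_measurable) auto
  have ends: "AE x in ?P. 0 \<le> u (x 0) \<and> 0 \<le> u' (x (int N))"
    using nn.product.AE_PiM_component[of "{0..int N}" 0 "\<lambda>y. 0 \<le> u y"]
      nn.product.AE_PiM_component[of "{0..int N}" "int N" "\<lambda>y. 0 \<le> u' y"] u u'
    by auto
  then show nonneg: "AE x in ?P. 0 \<le> ?h x"
    by eventually_elim (simp add: path_weight_nonneg)
  have i: "integrable M (\<lambda>y. (kernel_op M K ^^ N) u y * u' y)"
    by (rule L2_integrable_mult[OF kernel_op_funpow_L2[OF u(1)] u'(1)])
  have n: "AE y in M. 0 \<le> (kernel_op M K ^^ N) u y * u' y"
    using AE_funpow_nonneg[OF u, of N] u'(2) by eventually_elim simp
  have "(\<integral>\<^sup>+x. ennreal (?h x) \<partial>?P) = (\<integral>\<^sup>+x. nn_path (\<lambda>x y. ennreal (K x y)) (\<lambda>x. ennreal (u x)) (\<lambda>x. ennreal (u' x)) 0 (int N) x \<partial>?P)"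
    by (rule nn_integral_cong_AE)
       (use ends in \<open>eventually_elim, simp add: ennreal_path_weight\<close>)
  also have "\<dots> = (\<integral>\<^sup>+y. (nn_op M (\<lambda>x y. ennreal (K x y)) ^^ N) (\<lambda>x. ennreal (u x)) y * ennreal (u' y) \<partial>M)"
    using nn.nn_path_total[of "\<lambda>x. ennreal (u x)" "\<lambda>x. ennreal (u' x)" 0 N] by simp
  also have "\<dots> = (\<integral>\<^sup>+y. ennreal ((kernel_op M K ^^ N) u y * u' y) \<partial>M)"
    by (rule nn_integral_cong_AE)
       (use AE_nn_op_funpow[OF u, of N] u'(2) AE_funpow_nonneg[OF u, of N] in
         \<open>eventually_elim, simp add: ennreal_mult\<close>)
  also have "\<dots> = ennreal (\<integral>y. (kernel_op M K ^^ N) u y * u' y \<partial>M)"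
    by (rule nn_integral_eq_integral[OF i n])
  finally have "has_bochner_integral ?P ?h (\<integral>y. (kernel_op M K ^^ N) u y * u' y \<partial>M)"
    using integral_nonneg_AE[OF n] meas nonneg by (intro has_bochner_integral_nn_integral)
  then show "integrable ?P ?h" "(\<integral>x. ?h x \<partial>?P) = (\<integral>y. (kernel_op M K ^^ N) u y * u' y \<partial>M)"
    by (auto simp: has_bochner_integral_iff)
qed

lemma inner_left_pos:
  assumes g: "g \<in> L2 M" "AE x in M. 0 < g x"
  shows "0 < (\<integral>x. g x * w x \<partial>M)"
proof -
  have pos: "AE x in M. 0 < g x * w x"
    using g(2) left_pos by eventually_elim simp
  then have nonneg: "AE x in M. 0 \<le> g x * w x"
    by eventually_elim simp
  have "(\<integral>x. g x * w x \<partial>M) \<noteq> 0"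
  proof
    assume "(\<integral>x. g x * w x \<partial>M) = 0"
    then have "AE x in M. g x * w x = 0"
      using integral_nonneg_eq_0_iff_AE[OF L2_integrable_mult[OF g(1) left_L2] nonneg] by simp
    \<comment> \<open>The product \<open>g x * w x\<close> would be both positive and zero almost
      everywhere, so \<open>M\<close> would be the null measure; applied to \<open>v x * w x\<close>
      this contradicts the normalisation.\<close>
    with pos have "AE x in M. v x * w x = 0"
      by eventually_elim simp
    then have "(\<integral>x. v x * w x \<partial>M) = (\<integral>x. 0 \<partial>M)"
      by (intro integral_cong_AE) auto
    with normalised show False by simp
  qed
  with integral_nonneg_AE[OF nonneg] show ?thesis by linarith
qed

lemma inner_kernel_op_funpow:
  "g \<in> L2 M \<Longrightarrow> (\<integral>x. (kernel_op M K ^^ k) g x * w x \<partial>M) = (\<integral>x. g x * w x \<partial>M)"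
  by (induction k) (simp_all add: inner_kernel_op kernel_op_funpow_L2)

text \<open>With \<open>m = Suc k\<close> there are exactly \<open>k\<close> outer coordinates on
  each side, so integrating them out applies the operator \<open>k\<close> times to the left copy of
  \<open>f\<close> and its adjoint \<open>k\<close> times to the right one. Integrating over the
  window as well gives the normalising constant.\<close>

lemma chain_density_marginals:
  fixes f :: "'a \<Rightarrow> real" and n k :: nat
  assumes f: "f \<in> L2 M" "AE x in M. 0 \<le> f x"
  defines "N \<equiv> int n + 1"
    and "H \<equiv> path_weight K ((kernel_op M K ^^ k) f) ((kernel_op M (\<lambda>x y. K y x) ^^ k) f) 0 (int n + 1)"
  shows "chain_const M K f n (Suc k) = (\<integral>x. H x \<partial>PiM {0..N} (\<lambda>_. M))"
    and "AE x in PiM {0..N} (\<lambda>_. M). chain_marginal M K f n (Suc k) x = H x / chain_const M K f n (Suc k)"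
    and "chain_marginal M K f n (Suc k) \<in> borel_measurable (PiM {0..N} (\<lambda>_. M))"
proof -
  interpret T: perron_kernel M "\<lambda>x y. K y x" w v
    by (rule perron_kernel_transpose)
  let ?J = "outer_indices n (Suc k)" and ?a = "1 - int (Suc k)" and ?b = "int n + int (Suc k)"
  let ?I = "{0..N}"
  let ?PI = "PiM ?I (\<lambda>_. M)" and ?PJ = "PiM ?J (\<lambda>_. M)"
  let ?h = "path_weight K f f ?a ?b"
  let ?A = "(nn_op M (\<lambda>x y. ennreal (K x y)) ^^ k) (\<lambda>x. ennreal (f x))"
  let ?B = "(nn_op M (\<lambda>x y. ennreal (K y x)) ^^ k) (\<lambda>x. ennreal (f x))"
  let ?path = "nn_path (\<lambda>x y. ennreal (K x y)) (\<lambda>x. ennreal (f x)) (\<lambda>x. ennreal (f x)) ?a ?b"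
  have [measurable]: "f \<in> borel_measurable M" using f by (simp add: L2_def)
  have J: "?J = {- int k..-1} \<union> {N+1..N + int k}" "?a = - int k" "?b = N + int k"
    by (auto simp: outer_indices_def N_def)
  have IJ: "?I \<inter> ?J = {}" "finite ?I" "finite ?J" "?I \<union> ?J = {?a..?b}"
    unfolding J by (auto simp: N_def)
  interpret PJ: sigma_finite_measure ?PJ by (rule nn.product.sigma_finite) (fact IJ(3))
  have hm: "?h \<in> borel_measurable (PiM (?I \<union> ?J) (\<lambda>_. M))"
    unfolding IJ(4) by (rule path_weight_measurable) auto
  have hm2: "(\<lambda>(x, z). ?h (merge ?I ?J (x, z))) \<in> borel_measurable (?PI \<Otimes>\<^sub>M ?PJ)"
    using measurable_compose[OF measurable_merge hm] by (simp add: case_prod_beta')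
  have hm1: "(\<lambda>z. ?h (merge ?I ?J (x, z))) \<in> borel_measurable ?PJ" if "x \<in> space ?PI" for x
    using measurable_compose[OF measurable_Pair1'[OF that] hm2] by simp
  show "chain_marginal M K f n (Suc k) \<in> borel_measurable ?PI"
    unfolding chain_marginal_def chain_density_def J(1)[symmetric] N_def[symmetric]
    by (rule PJ.borel_measurable_lebesgue_integral) (use hm2 in measurable)
  have ends: "AE x in ?PI. AE z in ?PJ. 0 \<le> f (merge ?I ?J (x, z) ?a) \<and> 0 \<le> f (merge ?I ?J (x, z) ?b)"
    using nn.product.AE_merge_component[OF IJ(2,3), of ?a "\<lambda>y. 0 \<le> f y"]
      nn.product.AE_merge_component[OF IJ(2,3), of ?b "\<lambda>y. 0 \<le> f y"] f(2)
    unfolding IJ(4) by (simp add: eventually_conj_iff)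
  have inner: "AE x in ?PI. 0 \<le> H x \<and> (\<integral>\<^sup>+z. ennreal (?h (merge ?I ?J (x, z))) \<partial>?PJ) = ennreal (H x)"
  proof -
    have "AE x in ?PI. ?A (x 0) = ennreal ((kernel_op M K ^^ k) f (x 0)) \<and> 0 \<le> (kernel_op M K ^^ k) f (x 0)"
      using AE_nn_op_funpow[OF f, of k] AE_funpow_nonneg[OF f, of k] IJ(2)
      by (intro nn.product.AE_PiM_component) (auto simp: N_def)
    moreover have "AE x in ?PI. ?B (x N) = ennreal ((kernel_op M (\<lambda>x y. K y x) ^^ k) f (x N))
        \<and> 0 \<le> (kernel_op M (\<lambda>x y. K y x) ^^ k) f (x N)"
      using T.AE_nn_op_funpow[OF f, of k] T.AE_funpow_nonneg[OF f, of k] IJ(2)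
      by (intro nn.product.AE_PiM_component) (auto simp: N_def)
    ultimately show ?thesis
      using ends AE_space
    proof eventually_elim
      case (elim x)
      have "(\<integral>\<^sup>+z. ennreal (?h (merge ?I ?J (x, z))) \<partial>?PJ) = (\<integral>\<^sup>+z. ?path (merge ?I ?J (x, z)) \<partial>?PJ)"
        by (rule nn_integral_cong_AE)
           (use elim(3) in \<open>eventually_elim, simp add: ennreal_path_weight\<close>)
      also have "\<dots> = nn_path (\<lambda>x y. ennreal (K x y)) ?A ?B 0 N x"
        unfolding J by (rule nn.nn_path_extend) (use elim(4) in \<open>auto simp: N_def\<close>)
      also have "\<dots> = ennreal (H x)"
        unfolding H_def N_def using elim(1,2) by (intro ennreal_path_weight[symmetric]) (auto simp: N_def)
      finally show ?case
        using elim(1,2) by (simp add: H_def N_def path_weight_nonneg)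
    qed
  qed
  show "chain_const M K f n (Suc k) = (\<integral>x. H x \<partial>?PI)"
  proof -
    have "AE x in PiM (?I \<union> ?J) (\<lambda>_. M). 0 \<le> f (x ?a) \<and> 0 \<le> f (x ?b)"
      unfolding IJ(4) using f(2)
        nn.product.AE_PiM_component[of "{?a..?b}" ?a "\<lambda>y. 0 \<le> f y"]
        nn.product.AE_PiM_component[of "{?a..?b}" ?b "\<lambda>y. 0 \<le> f y"]
      by auto
    then have nonneg: "AE x in PiM (?I \<union> ?J) (\<lambda>_. M). 0 \<le> ?h x"
      by eventually_elim (simp add: path_weight_nonneg)
    have "chain_const M K f n (Suc k) = enn2real (\<integral>\<^sup>+x. ennreal (?h x) \<partial>PiM (?I \<union> ?J) (\<lambda>_. M))"
      unfolding chain_const_def IJ(4)[symmetric] by (rule integral_eq_nn_integral[OF hm nonneg])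
    also have "\<dots> = enn2real (\<integral>\<^sup>+x. \<integral>\<^sup>+z. ennreal (?h (merge ?I ?J (x, z))) \<partial>?PJ \<partial>?PI)"
      using hm by (subst nn.product.product_nn_integral_fold[OF IJ(1-3)]) auto
    also have "\<dots> = enn2real (\<integral>\<^sup>+x. ennreal (H x) \<partial>?PI)"
      using inner by (intro arg_cong[where f = enn2real] nn_integral_cong_AE) auto
    also have "\<dots> = (\<integral>x. H x \<partial>?PI)"
    proof (rule integral_eq_nn_integral[symmetric])
      show "H \<in> borel_measurable ?PI"
        unfolding H_def N_def
        by (intro path_weight_measurable L2_measurable kernel_op_funpow_L2 T.kernel_op_funpow_L2 f) auto
    qed (use inner in auto)
    finally show ?thesis .
  qed
  show "AE x in ?PI. chain_marginal M K f n (Suc k) x = H x / chain_const M K f n (Suc k)"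
    using inner ends AE_space
  proof eventually_elim
    case (elim x)
    have "AE z in ?PJ. 0 \<le> ?h (merge ?I ?J (x, z))"
      using elim(2) by eventually_elim (simp add: path_weight_nonneg)
    then have "(\<integral>z. ?h (merge ?I ?J (x, z)) \<partial>?PJ) = H x"
      using elim(1) hm1[OF elim(3)] by (simp add: integral_eq_nn_integral)
    then show ?case
      by (simp add: chain_marginal_def chain_density_def N_def)
  qed
qed

text \<open>The boundary functions are replaced one after the other: first \<open>a\<close> by
  \<open>\<alpha>\<close> times \<open>v\<close> with \<open>b\<close> kept, then \<open>b\<close>
  by \<open>\<beta>\<close> times \<open>w\<close>.\<close>

lemma path_weight_diff_le:
  assumes "0 \<le> \<alpha>"
  shows "\<bar>path_weight K a b 0 N x - \<alpha> * \<beta> * path_weight K v w 0 N x\<bar>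
    \<le> path_weight K (\<lambda>y. \<bar>a y - \<alpha> * v y\<bar>) (\<lambda>y. \<bar>b y\<bar>) 0 N x
      + \<alpha> * path_weight K (\<lambda>y. \<bar>v y\<bar>) (\<lambda>y. \<bar>b y - \<beta> * w y\<bar>) 0 N x"
proof -
  let ?p = "\<Prod>i\<in>{0+1..N}. K (x (i - 1)) (x i)"
  have p: "\<bar>?p\<bar> = ?p"
    by (intro abs_of_nonneg prod_nonneg) (auto simp: kernel_nonneg)
  have "path_weight K a b 0 N x - \<alpha> * \<beta> * path_weight K v w 0 N x
      = (a (x 0) - \<alpha> * v (x 0)) * ?p * b (x N) + \<alpha> * (v (x 0) * ?p * (b (x N) - \<beta> * w (x N)))"
    by (simp add: path_weight_def algebra_simps)
  also have "\<bar>\<dots>\<bar> \<le> \<bar>(a (x 0) - \<alpha> * v (x 0)) * ?p * b (x N)\<bar> + \<bar>\<alpha> * (v (x 0) * ?p * (b (x N) - \<beta> * w (x N)))\<bar>"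
    by (rule abs_triangle_ineq)
  finally show ?thesis
    using assms by (simp only: path_weight_def abs_mult p abs_of_nonneg)
qed

text \<open>The unnormalised marginal \<open>H\<close> is close in \<open>L1\<close> to
  \<open>\<gamma> * q\<close>, where \<open>q\<close> has mass 1, so its mass \<open>c\<close> is
  equally close to \<open>\<gamma>\<close>. Normalisation costs the same error once more, whence the
  factor 2 in the final constant.\<close>

theorem chain_tv_bound:
  assumes f: "f \<in> L2 M" "AE x in M. 0 < f x"
  obtains \<rho> D where "0 \<le> \<rho>" "\<rho> < 1"
    "\<And>n k. tv_dist
       (density (PiM {0..int n + 1} (\<lambda>_. M)) (\<lambda>x. ennreal (chain_marginal M K f n (Suc k) x)))
       (density (PiM {0..int n + 1} (\<lambda>_. M)) (\<lambda>x. ennreal (path_weight K v w 0 (int n + 1) x)))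
     \<le> D * \<rho> ^ k"
proof -
  interpret T: perron_kernel M "\<lambda>x y. K y x" w v
    by (rule perron_kernel_transpose)
  have f0: "AE x in M. 0 \<le> f x" using f(2) by eventually_elim simp
  have v0: "AE x in M. 0 \<le> v x" using right_pos by eventually_elim simp
  have w0: "AE x in M. 0 \<le> w x" using left_pos by eventually_elim simp
  define \<alpha> where "\<alpha> = (\<integral>x. f x * w x \<partial>M)"
  define \<beta> where "\<beta> = (\<integral>x. f x * v x \<partial>M)"
  define \<gamma> where "\<gamma> = \<alpha> * \<beta>"
  have \<alpha>: "0 < \<alpha>" and \<beta>: "0 < \<beta>"
    unfolding \<alpha>_def \<beta>_def by (intro inner_left_pos T.inner_left_pos f)+
  then have \<gamma>: "0 < \<gamma>" by (simp add: \<gamma>_def)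
  obtain \<kappa>1 D1 where g1: "0 \<le> \<kappa>1" "\<kappa>1 < 1" "0 \<le> D1"
    "\<And>g k. g \<in> L2 M \<Longrightarrow>
       L2_norm M (\<lambda>x. (kernel_op M K ^^ k) g x - (\<integral>x. g x * w x \<partial>M) * v x) \<le> D1 * \<kappa>1 ^ k * L2_norm M g"
    using spectral_gap by blast
  obtain \<kappa>2 D2 where g2: "0 \<le> \<kappa>2" "\<kappa>2 < 1" "0 \<le> D2"
    "\<And>g k. g \<in> L2 M \<Longrightarrow>
       L2_norm M (\<lambda>x. (kernel_op M (\<lambda>x y. K y x) ^^ k) g x - (\<integral>x. g x * v x \<partial>M) * w x) \<le> D2 * \<kappa>2 ^ k * L2_norm M g"
    using T.spectral_gap by blast
  obtain B1 where B1: "0 \<le> B1"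
    "\<And>(g :: 'a \<Rightarrow> real) k. g \<in> L2 M \<Longrightarrow> L2_norm M ((kernel_op M K ^^ k) g) \<le> B1 * L2_norm M g"
    using power_bounded by blast
  obtain B2 where B2: "0 \<le> B2"
    "\<And>(g :: 'a \<Rightarrow> real) k. g \<in> L2 M \<Longrightarrow> L2_norm M ((kernel_op M (\<lambda>x y. K y x) ^^ k) g) \<le> B2 * L2_norm M g"
    using T.power_bounded by blast
  define \<rho> where "\<rho> = max \<kappa>1 \<kappa>2"
  have \<rho>: "0 \<le> \<rho>" "\<rho> < 1" using g1 g2 by (auto simp: \<rho>_def)
  \<comment> \<open>One summand for each term of \<open>path_weight_diff_le\<close>:
    \<open>B1\<close> bounds the path integral for every window length, \<open>D1\<close> and
    \<open>D2\<close> are the spectral gap constants of the two ends, and \<open>B2\<close> bounds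
    the right boundary function.\<close>
  define D where "D = B1 * (D1 * L2_norm M f) * (B2 * L2_norm M f)
    + \<alpha> * (B1 * L2_norm M v * (D2 * L2_norm M f))"
  have d1: "L2_norm M (\<lambda>x. (kernel_op M K ^^ k) f x - \<alpha> * v x) \<le> D1 * L2_norm M f * \<rho> ^ k" for k
  proof -
    have "D1 * L2_norm M f * \<kappa>1 ^ k \<le> D1 * L2_norm M f * \<rho> ^ k"
      using g1 by (intro mult_left_mono power_mono) (auto simp: \<rho>_def)
    then show ?thesis using g1(4)[OF f(1), of k, folded \<alpha>_def] by (simp add: mult_ac)
  qed
  have d2: "L2_norm M (\<lambda>x. (kernel_op M (\<lambda>x y. K y x) ^^ k) f x - \<beta> * w x) \<le> D2 * L2_norm M f * \<rho> ^ k" for k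
  proof -
    have "D2 * L2_norm M f * \<kappa>2 ^ k \<le> D2 * L2_norm M f * \<rho> ^ k"
      using g2 by (intro mult_left_mono power_mono) (auto simp: \<rho>_def)
    then show ?thesis using g2(4)[OF f(1), of k, folded \<beta>_def] by (simp add: mult_ac)
  qed
  have path_le: "(\<integral>x. path_weight K g h 0 (int N) x \<partial>PiM {0..int N} (\<lambda>_. M)) \<le> B1 * L2_norm M g * L2_norm M h"
    if "g \<in> L2 M" "AE x in M. 0 \<le> g x" "h \<in> L2 M" "AE x in M. 0 \<le> h x" for g h N
  proof -
    have "(\<integral>y. (kernel_op M K ^^ N) g y * h y \<partial>M) \<le> L2_norm M ((kernel_op M K ^^ N) g) * L2_norm M h"
      using L2_Cauchy_Schwarz[OF kernel_op_funpow_L2[OF that(1)] that(3), of N] by linarith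
    also have "\<dots> \<le> B1 * L2_norm M g * L2_norm M h"
      using B1(2)[OF that(1)] by (intro mult_right_mono) auto
    finally show ?thesis by (simp add: path_weight_integral that)
  qed
  show thesis
  proof
    show "0 \<le> \<rho>" "\<rho> < 1" by fact+
    fix n k :: nat
    define N where "N = Suc n"
    have N: "int n + 1 = int N" by (simp add: N_def)
    let ?P = "PiM {0..int N} (\<lambda>_. M)"
    define a where "a = (kernel_op M K ^^ k) f"
    define b where "b = (kernel_op M (\<lambda>x y. K y x) ^^ k) f"
    define H where "H = path_weight K a b 0 (int N)"
    define q where "q = path_weight K v w 0 (int N)"
    define c where "c = chain_const M K f n (Suc k)"
    have a: "a \<in> L2 M" "AE x in M. 0 \<le> a x"
      unfolding a_def by (intro kernel_op_funpow_L2 AE_funpow_nonneg f(1) f0)+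
    have b: "b \<in> L2 M" "AE x in M. 0 \<le> b x"
      unfolding b_def by (intro T.kernel_op_funpow_L2 T.AE_funpow_nonneg f(1) f0)+
    note H = path_weight_integral[OF a b, of N, folded H_def]
    note q = path_weight_integral[OF right_L2 v0 left_L2 w0, of N, folded q_def]
    have q1: "(\<integral>x. q x \<partial>?P) = 1"
      using q(2) by (simp add: inner_kernel_op_funpow right_L2 normalised)
    note marg = chain_density_marginals[OF f(1) f0, of n k, folded a_def b_def, unfolded N, folded H_def c_def]
    have av: "(\<lambda>y. a y - \<alpha> * v y) \<in> L2 M" and bw: "(\<lambda>y. b y - \<beta> * w y) \<in> L2 M"
      by (intro L2_diff L2_cmult a b right_L2 left_L2)+
    let ?h1 = "path_weight K (\<lambda>y. \<bar>a y - \<alpha> * v y\<bar>) (\<lambda>y. \<bar>b y\<bar>) 0 (int N)"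
    let ?h2 = "path_weight K (\<lambda>y. \<bar>v y\<bar>) (\<lambda>y. \<bar>b y - \<beta> * w y\<bar>) 0 (int N)"
    have i: "integrable ?P ?h1" "integrable ?P ?h2"
      by (intro path_weight_integral(1) L2_abs av bw right_L2 b; simp)+
    have diff: "(\<integral>x. \<bar>H x - \<gamma> * q x\<bar> \<partial>?P) \<le> D * \<rho> ^ k"
    proof -
      have "(\<integral>x. \<bar>H x - \<gamma> * q x\<bar> \<partial>?P) \<le> (\<integral>x. ?h1 x + \<alpha> * ?h2 x \<partial>?P)"
        using path_weight_diff_le[of \<alpha> a b "int N" _ \<beta>] \<alpha> H(1) q(1) i
        by (intro integral_mono) (auto simp: H_def q_def \<gamma>_def)
      also have "\<dots> = (\<integral>x. ?h1 x \<partial>?P) + \<alpha> * (\<integral>x. ?h2 x \<partial>?P)"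
        using i by simp
      also have "\<dots> \<le> B1 * L2_norm M (\<lambda>y. \<bar>a y - \<alpha> * v y\<bar>) * L2_norm M (\<lambda>y. \<bar>b y\<bar>)
          + \<alpha> * (B1 * L2_norm M (\<lambda>y. \<bar>v y\<bar>) * L2_norm M (\<lambda>y. \<bar>b y - \<beta> * w y\<bar>))"
        using \<alpha> by (intro add_mono mult_left_mono path_le L2_abs av bw right_L2 b) auto
      also have "\<dots> = B1 * L2_norm M (\<lambda>y. a y - \<alpha> * v y) * L2_norm M b
          + \<alpha> * (B1 * L2_norm M v * L2_norm M (\<lambda>y. b y - \<beta> * w y))"
        by simp
      also have "\<dots> \<le> B1 * (D1 * L2_norm M f * \<rho> ^ k) * (B2 * L2_norm M f)
          + \<alpha> * (B1 * L2_norm M v * (D2 * L2_norm M f * \<rho> ^ k))"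
        using \<alpha> B1(1) B2(2)[OF f(1), of k] d1[of k] d2[of k] g1(3) \<rho>(1)
        unfolding a_def b_def
        by (intro add_mono mult_left_mono mult_mono) auto
      also have "\<dots> = D * \<rho> ^ k"
        by (simp add: D_def algebra_simps)
      finally show ?thesis .
    qed
    have c: "c = (\<integral>x. H x \<partial>?P)" "0 \<le> c"
      using marg(1) integral_nonneg_AE[OF H(3)] by auto
    have c_near: "\<bar>c - \<gamma>\<bar> \<le> D * \<rho> ^ k"
    proof -
      have "c - \<gamma> = (\<integral>x. H x - \<gamma> * q x \<partial>?P)"
        using H(1) q(1) q1 c(1) by simp
      then show ?thesis
        using integral_abs_bound[of ?P "\<lambda>x. H x - \<gamma> * q x"] diff by linarith
    qed
    have "tv_dist (density ?P (\<lambda>x. ennreal (chain_marginal M K f n (Suc k) x))) (density ?P (\<lambda>x. ennreal (q x)))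
        \<le> (\<integral>x. \<bar>chain_marginal M K f n (Suc k) x - q x\<bar> \<partial>?P)"
    proof (rule tv_dist_density_le[OF _ q(1) _ q(3)])
      show "integrable ?P (chain_marginal M K f n (Suc k))"
        using H(1) marg(2,3) by (subst integrable_cong_AE[where g = "\<lambda>x. H x / c"]) auto
      show "AE x in ?P. 0 \<le> chain_marginal M K f n (Suc k) x"
        using marg(2) H(3) by eventually_elim (simp add: c(2))
    qed
    also have "\<dots> = (\<integral>x. \<bar>H x / c - q x\<bar> \<partial>?P)"
      using marg(2,3) H(1) q(1) by (intro integral_cong_AE) (auto elim: eventually_mono)
    also have "\<dots> \<le> (\<integral>x. H x * \<bar>1 / c - 1 / \<gamma>\<bar> + \<bar>H x - \<gamma> * q x\<bar> / \<gamma> \<partial>?P)"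
    proof (rule integral_mono_AE)
      show "AE x in ?P. \<bar>H x / c - q x\<bar> \<le> H x * \<bar>1 / c - 1 / \<gamma>\<bar> + \<bar>H x - \<gamma> * q x\<bar> / \<gamma>"
        using H(3)
      proof eventually_elim
        case (elim x)
        \<comment> \<open>Compare both densities with \<open>H x / \<gamma>\<close>: the first
          summand is the error of the constant, the second that of the path weight.\<close>
        have "H x / c - q x = H x * (1 / c - 1 / \<gamma>) + (H x - \<gamma> * q x) / \<gamma>"
          using \<gamma> by (simp add: algebra_simps diff_divide_distrib)
        also have "\<bar>\<dots>\<bar> \<le> \<bar>H x * (1 / c - 1 / \<gamma>)\<bar> + \<bar>(H x - \<gamma> * q x) / \<gamma>\<bar>"
          by (rule abs_triangle_ineq)
        finally show ?case
          using elim \<gamma> by (simp add: abs_mult)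
      qed
    qed (use H(1) q(1) in auto)
    also have "\<dots> = c * \<bar>1 / c - 1 / \<gamma>\<bar> + (\<integral>x. \<bar>H x - \<gamma> * q x\<bar> \<partial>?P) / \<gamma>"
      using H(1) q(1) c(1) by simp
    \<comment> \<open>As \<open>c\<close> is the integral of \<open>H\<close>, no lower bound on \<open>c\<close> uniform in \<open>n\<close> is needed
      (and \<open>c = 0\<close> is harmless because \<open>1 / 0 = 0\<close>).\<close>
    also have "c * \<bar>1 / c - 1 / \<gamma>\<bar> \<le> \<bar>c - \<gamma>\<bar> / \<gamma>"
    proof (cases "c = 0")
      case False
      then have "c * \<bar>1 / c - 1 / \<gamma>\<bar> = \<bar>c * (1 / c - 1 / \<gamma>)\<bar>"
        using c(2) by (simp add: abs_mult)
      also have "c * (1 / c - 1 / \<gamma>) = (\<gamma> - c) / \<gamma>"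
        using False \<gamma> by (simp add: field_simps)
      finally show ?thesis using \<gamma> by (simp add: abs_minus_commute)
    qed (use \<gamma> in simp)
    also have "\<bar>c - \<gamma>\<bar> / \<gamma> + (\<integral>x. \<bar>H x - \<gamma> * q x\<bar> \<partial>?P) / \<gamma> \<le> D * \<rho> ^ k / \<gamma> + D * \<rho> ^ k / \<gamma>"
      using \<gamma> c_near diff by (intro add_mono divide_right_mono) auto
    also have "\<dots> = 2 * D / \<gamma> * \<rho> ^ k"
      by simp
    finally show "tv_dist
       (density (PiM {0..int n + 1} (\<lambda>_. M)) (\<lambda>x. ennreal (chain_marginal M K f n (Suc k) x)))
       (density (PiM {0..int n + 1} (\<lambda>_. M)) (\<lambda>x. ennreal (path_weight K v w 0 (int n + 1) x)))
     \<le> 2 * D / \<gamma> * \<rho> ^ k"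
      unfolding N q_def by simp
  qed
qed

end

section \<open>The interaction kernel\<close>

lemma interaction_kernel_pos: "0 < interaction_kernel s c \<theta> \<Phi>0 \<Phi>1 x y"
  by (simp add: interaction_kernel_def node_factor_def edge_factor_def)

lemma interaction_kernel_measurable:
  fixes \<mu>a :: "'p::finite \<Rightarrow> real measure"
  assumes sets: "\<And>a. sets (\<mu>a a) = sets (restrict_space borel (\<X> a))"
    and [measurable]: "\<And>a. s a \<in> borel_measurable (\<mu>a a)" "\<And>a. c a \<in> borel_measurable (\<mu>a a)"
  shows "(\<lambda>(x, y). interaction_kernel s c \<theta> \<Phi>0 \<Phi>1 x y) \<in> borel_measurable (PiM UNIV \<mu>a \<Otimes>\<^sub>M PiM UNIV \<mu>a)"
proof -
  have id: "(\<lambda>x. x) \<in> borel_measurable (\<mu>a a)" for a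
  proof -
    have "(\<lambda>x. x) \<in> borel_measurable (restrict_space borel (\<X> a))"
      by (intro measurable_restrict_space1) simp
    then show ?thesis using measurable_cong_sets[OF sets refl] by blast
  qed
  have comp [measurable]: "(\<lambda>x. x a) \<in> borel_measurable (PiM UNIV \<mu>a)" for a
    using measurable_compose[OF measurable_component_singleton[of a UNIV \<mu>a] id] by simp
  have [measurable]: "(\<lambda>x. s a (x a)) \<in> borel_measurable (PiM UNIV \<mu>a)"
      "(\<lambda>x. c a (x a)) \<in> borel_measurable (PiM UNIV \<mu>a)" for a
    by (intro measurable_compose[OF measurable_component_singleton]; simp)+
  have node [measurable]: "node_factor s c \<theta> \<Phi>0 \<in> borel_measurable (PiM UNIV \<mu>a)"
    unfolding node_factor_def[abs_def] by (simp add: inner_vec_def matrix_vector_mult_def)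
  have "(\<lambda>(x, y). edge_factor \<Phi>1 x y) \<in> borel_measurable (PiM UNIV \<mu>a \<Otimes>\<^sub>M PiM UNIV \<mu>a)"
    unfolding edge_factor_def[abs_def] by (simp add: inner_vec_def matrix_vector_mult_def case_prod_beta')
  note this[measurable]
  show ?thesis
    unfolding interaction_kernel_def[abs_def] by measurable
qed

theorem theorem3p2:
  fixes \<X> :: "'p::finite \<Rightarrow> real set"
    and \<mu>a :: "'p \<Rightarrow> real measure"
    and s c :: "'p \<Rightarrow> real \<Rightarrow> real"
    and \<theta> :: "real^'p"
    and \<Phi>0 \<Phi>1 :: "real^'p^'p"
    and \<mu> :: "('p \<Rightarrow> real) measure"
    and R :: "('p \<Rightarrow> real) \<Rightarrow> ('p \<Rightarrow> real) \<Rightarrow> real"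
    and f :: "('p \<Rightarrow> real) \<Rightarrow> real"
    and P :: "'w measure"
    and X :: "int \<Rightarrow> 'w \<Rightarrow> ('p \<Rightarrow> real)"
    and p :: "nat \<Rightarrow> (int \<Rightarrow> 'p \<Rightarrow> real) \<Rightarrow> ennreal"
  assumes "\<And>a. \<X> a \<in> sets borel"
    and "\<And>a. sets (\<mu>a a) = sets (restrict_space borel (\<X> a))"
    and "\<And>a. sigma_finite_measure (\<mu>a a)"
    and "\<And>a. s a \<in> borel_measurable (\<mu>a a)"
    and "\<And>a. c a \<in> borel_measurable (\<mu>a a)"
    and "transpose \<Phi>0 = \<Phi>0"
    and "\<And>a. \<Phi>0 $ a $ a = 0"
    and "\<mu> = PiM UNIV \<mu>a"
    and "R = interaction_kernel s c \<theta> \<Phi>0 \<Phi>1"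
    and "(\<integral>\<^sup>+(x, y). ennreal ((R x y)\<^sup>2) \<partial>(\<mu> \<Otimes>\<^sub>M \<mu>)) < \<infinity>"
    and "f \<in> L2 \<mu>"
    and "AE x in \<mu>. 0 < f x"
    and "CEStGM_process \<mu> R P X"
    and "\<And>n. distributed P (PiM {0..int n + 1} (\<lambda>_. \<mu>)) (\<lambda>\<omega>. \<lambda>t\<in>{0..int n + 1}. X t \<omega>) (p n)"
  shows "\<exists>\<rho>::real. 0 \<le> \<rho> \<and> \<rho> < 1 \<and>
           (\<exists>K. \<forall>n>0. \<forall>m>0.
              tv_dist
                (density (PiM {0..int n + 1} (\<lambda>_. \<mu>)) (\<lambda>x. ennreal (chain_marginal \<mu> R f n m x)))
                (density (PiM {0..int n + 1} (\<lambda>_. \<mu>)) (p n))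
              \<le> K * \<rho> ^ (m - 1))"
proof -
  have R_pos: "0 < R x y" for x y
    by (simp add: assms(9) interaction_kernel_pos)
  interpret factors: product_sigma_finite \<mu>a
    by (intro product_sigma_finite.intro assms(3))
  have sf: "sigma_finite_measure \<mu>"
    unfolding assms(8) by (rule factors.sigma_finite) simp
  have R_meas: "(\<lambda>(x, y). R x y) \<in> borel_measurable (\<mu> \<Otimes>\<^sub>M \<mu>)"
    unfolding assms(8,9) by (rule interaction_kernel_measurable[OF assms(2,4,5)])
  have R_int: "integrable (\<mu> \<Otimes>\<^sub>M \<mu>) (\<lambda>(x, y). (R x y)\<^sup>2)"
  proof (rule integrableI_nonneg)
    show "(\<lambda>(x, y). (R x y)\<^sup>2) \<in> borel_measurable (\<mu> \<Otimes>\<^sub>M \<mu>)"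
      using borel_measurable_power[OF R_meas, of 2] by (simp add: case_prod_beta')
    show "(\<integral>\<^sup>+z. ennreal (case z of (x, y) \<Rightarrow> (R x y)\<^sup>2) \<partial>(\<mu> \<Otimes>\<^sub>M \<mu>)) < \<infinity>"
      using assms(10) by (simp add: case_prod_beta')
  qed auto
  obtain r v w where perron: "perron_triple \<mu> R r v w"
    and dens: "\<And>n :: nat. distributed P (PiM {0..int n + 1} (\<lambda>_. \<mu>)) (\<lambda>\<omega>. \<lambda>t\<in>{0..int n + 1}. X t \<omega>)
           (\<lambda>x. ennreal (path_weight R v w 0 (int n + 1) x / r ^ (n + 1)))"
    using assms(13) unfolding CEStGM_process_def by blast
  have r: "0 < r" using perron by (simp add: perron_triple_def)
  \<comment> \<open>Division by the spectral radius normalises the eigenvalue to 1. It leaves the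
    chain marginals unchanged and absorbs the power of \<open>r\<close> in the process
    density.\<close>
  define S where "S = (\<lambda>x y. 1 / r * R x y)"
  have S_op: "kernel_op \<mu> S g y = 1 / r * kernel_op \<mu> R g y"
    "kernel_op_adj \<mu> S g y = 1 / r * kernel_op_adj \<mu> R g y" for g :: "('p \<Rightarrow> real) \<Rightarrow> real" and y
    by (simp_all add: S_def kernel_op_def kernel_op_adj_def)
  interpret perron_kernel \<mu> S v w
  proof (intro perron_kernel.intro hs_kernel.intro sf hs_kernel_axioms.intro perron_kernel_axioms.intro)
    have "(\<lambda>z. 1 / r * (case z of (x, y) \<Rightarrow> R x y)) \<in> L2 (\<mu> \<Otimes>\<^sub>M \<mu>)"
      using R_meas R_int by (intro L2_cmult) (simp add: L2_real_iff case_prod_beta')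
    then show "(\<lambda>(x, y). S x y) \<in> L2 (\<mu> \<Otimes>\<^sub>M \<mu>)"
      by (simp add: S_def case_prod_beta')
    show "0 < S x y" for x y
      using r R_pos[of x y] by (simp add: S_def)
    have "AE y in \<mu>. kernel_op \<mu> R v y = r * v y" "AE x in \<mu>. kernel_op_adj \<mu> R w x = r * w x"
      using perron unfolding perron_triple_def by blast+
    then show "AE y in \<mu>. kernel_op \<mu> S v y = v y" "AE x in \<mu>. kernel_op_adj \<mu> S w x = w x"
      by (eventually_elim, use r in \<open>simp add: S_op\<close>)+
  qed (use perron in \<open>auto simp: perron_triple_def\<close>)
  obtain \<rho> D where bound: "0 \<le> \<rho>" "\<rho> < 1"
    "\<And>n k. tv_dist
       (density (PiM {0..int n + 1} (\<lambda>_. \<mu>)) (\<lambda>x. ennreal (chain_marginal \<mu> S f n (Suc k) x)))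
       (density (PiM {0..int n + 1} (\<lambda>_. \<mu>)) (\<lambda>x. ennreal (path_weight S v w 0 (int n + 1) x)))
     \<le> D * \<rho> ^ k"
    using chain_tv_bound[OF assms(11,12)] by blast
  have marg: "chain_marginal \<mu> S f n m = chain_marginal \<mu> R f n m" for n m
    unfolding S_def using r by (intro chain_marginal_scale) simp
  have "path_weight S v w 0 (int n + 1) x = path_weight R v w 0 (int n + 1) x / r ^ (n + 1)" for n x
  proof -
    have "nat (int n + 1 - 0) = n + 1" by simp
    then show ?thesis unfolding S_def path_weight_scale by (simp add: power_one_over field_simps)
  qed
  \<comment> \<open>Both functions are densities of the same window law, so the two density measures
    coincide whichever version \<open>p n\<close> is.\<close>
  then have p: "density (PiM {0..int n + 1} (\<lambda>_. \<mu>)) (\<lambda>x. ennreal (path_weight S v w 0 (int n + 1) x))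
      = density (PiM {0..int n + 1} (\<lambda>_. \<mu>)) (p n)" for n
    using dens[of n] assms(14)[of n] by (simp add: distributed_def)
  have "tv_dist
      (density (PiM {0..int n + 1} (\<lambda>_. \<mu>)) (\<lambda>x. ennreal (chain_marginal \<mu> R f n m x)))
      (density (PiM {0..int n + 1} (\<lambda>_. \<mu>)) (p n)) \<le> D * \<rho> ^ (m - 1)" if "0 < m" for n m
    \<comment> \<open>Positivity of \<open>m\<close> is what makes \<open>Suc (m - 1)\<close> equal
      to \<open>m\<close> in truncated subtraction.\<close>
    using bound(3)[of n "m - 1"] that by (simp add: marg p)
  with bound(1,2) show ?thesis by blast
qed

end
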